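(* Let $T>0$ and fix $\varepsilon>0$. Let $V_1\in C_b(\mathbb{R}^d;[0,+\infty))\cap C^1(\mathbb{R}^d)$ satisfy $\|V_1\|_{L^1}=1$, $V_1(x)=V_1(-x)$, $\int_{\mathbb{R}^d}|x|^2V_1(x)\,dx<+\infty$, $|\nabla V_1|\in L^1(\mathbb{R}^d)$ and $|\nabla V_1(x)|\le C(1+|x|)$ for some constant $C$, and let $V_\varepsilon(x)=\varepsilon^{-d}V_1(x/\varepsilon)$. Let $F:[0,+\infty)\to(-\infty,+\infty]$ be proper, convex and lower semicontinuous with $F(0)=0$, $\liminf_{s\uparrow+\infty}F(s)/s=+\infty$, $\liminf_{s\downarrow0}F(s)/s^{\alpha}>-\infty$ for some $\alpha>\frac{d}{d+2}$, and assume $F\in C^1([0,+\infty))$. Let $\rho_0\in\mathcal{P}_2(\mathbb{R}^d)$ with $\mathcal{F}^\varepsilon[\rho_0]<+\infty$. Then there exists a weak measure solution $\rho^\varepsilon:[0,T]\to\mathcal{P}_2(\mathbb{R}^d)$ of $$\partial_t\rho=\nabla\cdot\big(\rho\,\nabla V_\varepsilon*F'(V_\varepsilon*\rho)\big)$$ such that $\rho^\varepsilon(0)=\rho_0$.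
   Context: $\mathcal{P}_2(\mathbb{R}^d)$ is the set of Borel probability measures on $\mathbb{R}^d$ with finite second moment, endowed with the 2-Wasserstein distance $d_W$. The regularised energy is $\mathcal{F}^\varepsilon[\rho]:=\int_{\mathbb{R}^d}F(V_\varepsilon*\rho(x))\,dx$ for $\rho\in\mathcal{P}_2(\mathbb{R}^d)$. Weak measure solution: an absolutely continuous curve $\rho^\varepsilon:[0,T]\to\mathcal{P}_2(\mathbb{R}^d)$, $t\mapsto\rho^\varepsilon_t$ (with respect to $d_W$), such that for every $\varphi\in C^1_c(\mathbb{R}^d)$ and every $t\in[0,T]$ $$\int_{\mathbb{R}^d}\varphi\,d\rho^\varepsilon_t-\int_{\mathbb{R}^d}\varphi\,d\rho_0=-\int_0^t\int_{\mathbb{R}^d}\nabla\varphi(x)\cdot[\nabla V_\varepsilon*F'(V_\varepsilon*\rho^\varepsilon_s)](x)\,d\rho^\varepsilon_s(x)\,ds.$$ *)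

theory Defs
  imports "HOL-Probability.Probability"
begin

section \<open>Wasserstein space\<close>

definition P2 :: "'a::euclidean_space measure set" where
  "P2 = {\<mu>. prob_space \<mu> \<and> sets \<mu> = sets borel \<and> integrable \<mu> (\<lambda>x. (norm x)\<^sup>2)}"

definition couplings ::
  "'a::euclidean_space measure \<Rightarrow> 'a measure \<Rightarrow> ('a \<times> 'a) measure set" where
  "couplings \<mu> \<nu> = {\<pi>. sets \<pi> = sets borel \<and> distr \<pi> borel fst = \<mu> \<and> distr \<pi> borel snd = \<nu>}"

text \<open>Only used for measures in \<^const>\<open>P2\<close>: there every coupling has finite cost and the product
  measure is a coupling, so the real-valued infimum is the usual one.\<close>

definition dW :: "'a::euclidean_space measure \<Rightarrow> 'a measure \<Rightarrow> real" where
  "dW \<mu> \<nu> = sqrt (INF \<pi>\<in>couplings \<mu> \<nu>. \<integral>z. (dist (fst z) (snd z))\<^sup>2 \<partial>\<pi>)"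

text \<open>Absolute continuity of curves in the metric space \<open>(P2, dW)\<close>, in the sense of Ambrosio, Gigli
  and Savare: the increments are dominated by the integral of an \<open>L\<^sup>1\<close> function.\<close>

definition AC_curve :: "real \<Rightarrow> (real \<Rightarrow> 'a::euclidean_space measure) \<Rightarrow> bool" where
  "AC_curve T \<rho> \<longleftrightarrow>
     (\<forall>t\<in>{0..T}. \<rho> t \<in> P2) \<and>
     (\<exists>m :: real \<Rightarrow> real. set_integrable lborel {0..T} m \<and>
        (\<forall>s t. 0 \<le> s \<and> s \<le> t \<and> t \<le> T \<longrightarrow> dW (\<rho> s) (\<rho> t) \<le> (LBINT r:{s..t}. m r)))"

section \<open>Functions on Euclidean space\<close>

definition grad :: "('a::euclidean_space \<Rightarrow> real) \<Rightarrow> 'a \<Rightarrow> 'a" where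
  "grad f x = (THE D. GDERIV f x :> D)"

definition C1 :: "('a::euclidean_space \<Rightarrow> real) \<Rightarrow> bool" where
  "C1 f \<longleftrightarrow> (\<forall>x. f differentiable (at x)) \<and> continuous_on UNIV (grad f)"

definition C1c :: "('a::euclidean_space \<Rightarrow> real) \<Rightarrow> bool" where
  "C1c f \<longleftrightarrow> C1 f \<and> compact (closure {x. f x \<noteq> 0})"

definition rescale :: "real \<Rightarrow> ('a::euclidean_space \<Rightarrow> real) \<Rightarrow> 'a \<Rightarrow> real" where
  "rescale \<epsilon> V x = V (x /\<^sub>R \<epsilon>) / \<epsilon> ^ DIM('a)"

definition conv_measure :: "('a::euclidean_space \<Rightarrow> real) \<Rightarrow> 'a measure \<Rightarrow> 'a \<Rightarrow> real" where
  "conv_measure V \<rho> x = (\<integral>y. V (x - y) \<partial>\<rho>)"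

definition conv_fun :: "('a::euclidean_space \<Rightarrow> 'a) \<Rightarrow> ('a \<Rightarrow> real) \<Rightarrow> 'a \<Rightarrow> 'a" where
  "conv_fun G g x = (\<integral>y. g y *\<^sub>R G (x - y) \<partial>lborel)"

section \<open>Internal energy densities\<close>

text \<open>A function \<open>[0,\<infinity>) \<rightarrow> (-\<infinity>,\<infinity>]\<close> is represented by \<open>F :: real \<Rightarrow> ereal\<close>; all notions below depend
  only on the values of \<open>F\<close> on \<open>[0,\<infinity>)\<close>.\<close>

definition proper_halfline :: "(real \<Rightarrow> ereal) \<Rightarrow> bool" where
  "proper_halfline F \<longleftrightarrow> (\<forall>s\<ge>0. F s \<noteq> - \<infinity>) \<and> (\<exists>s\<ge>0. F s \<noteq> \<infinity>)"

text \<open>Here \<open>0 * \<infinity> = 0\<close>, as is the convention for \<^typ>\<open>ereal\<close>.\<close>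

definition convex_halfline :: "(real \<Rightarrow> ereal) \<Rightarrow> bool" where
  "convex_halfline F \<longleftrightarrow>
     (\<forall>r\<ge>0. \<forall>s\<ge>0. \<forall>u\<in>{0..1}.
        F (u * r + (1 - u) * s) \<le> ereal u * F r + ereal (1 - u) * F s)"

definition lsc_halfline :: "(real \<Rightarrow> ereal) \<Rightarrow> bool" where
  "lsc_halfline F \<longleftrightarrow> (\<forall>s\<ge>0. F s \<le> Liminf (at s within {0..}) F)"

text \<open>The derivative on \<open>[0,\<infinity>)\<close>, one-sided at \<open>0\<close>.\<close>

definition deriv_halfline :: "(real \<Rightarrow> ereal) \<Rightarrow> real \<Rightarrow> real" where
  "deriv_halfline F s = vector_derivative (\<lambda>r. real_of_ereal (F r)) (at s within {0..})"

definition C1_halfline :: "(real \<Rightarrow> ereal) \<Rightarrow> bool" where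
  "C1_halfline F \<longleftrightarrow>
     (\<forall>s\<ge>0. \<bar>F s\<bar> \<noteq> \<infinity>) \<and>
     (\<forall>s\<ge>0. (\<lambda>r. real_of_ereal (F r)) differentiable (at s within {0..})) \<and>
     continuous_on {0..} (deriv_halfline F)"

section \<open>Nonlocal energy and weak measure solutions\<close>

text \<open>The integral of an extended-real function as the difference of the integrals of its positive and
  negative parts (\<^const>\<open>e2ennreal\<close> truncates negative values to \<open>0\<close>). If both parts are infinite, the value is
  \<open>\<infinity> - \<infinity> = \<infinity>\<close>, so a value \<open>< \<infinity>\<close> always means that the positive part is integrable.\<close>

definition ext_integral :: "'a measure \<Rightarrow> ('a \<Rightarrow> ereal) \<Rightarrow> ereal" where
  "ext_integral M f =
     enn2ereal (\<integral>\<^sup>+x. e2ennreal (f x) \<partial>M) - enn2ereal (\<integral>\<^sup>+x. e2ennreal (- f x) \<partial>M)"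

definition energy ::
  "('a::euclidean_space \<Rightarrow> real) \<Rightarrow> (real \<Rightarrow> ereal) \<Rightarrow> 'a measure \<Rightarrow> ereal" where
  "energy V F \<rho> = ext_integral lborel (\<lambda>x. F (conv_measure V \<rho> x))"

text \<open>The vector field \<open>\<nabla>V * F'(V * \<rho>)\<close>.\<close>

definition drift ::
  "('a::euclidean_space \<Rightarrow> real) \<Rightarrow> (real \<Rightarrow> ereal) \<Rightarrow> 'a measure \<Rightarrow> 'a \<Rightarrow> 'a" where
  "drift V F \<rho> = conv_fun (grad V) (\<lambda>y. deriv_halfline F (conv_measure V \<rho> y))"

text \<open>Weak measure solutions of \<open>\<partial>\<^sub>t\<rho> = \<nabla> \<cdot> (\<rho> \<nabla>V * F'(V * \<rho>))\<close> on \<open>[0,T]\<close> with datum \<open>\<rho>0\<close>. If \<open>V \<ge> 0\<close> is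
  bounded and \<open>C\<^sup>1\<close> with integrable gradient and \<open>F\<close> is \<open>C\<^sup>1\<close> on \<open>[0,\<infinity>)\<close>, all integrals below exist:
  the field is bounded and continuous, and \<open>s \<mapsto> \<rho> s\<close> is narrowly continuous.\<close>

definition weak_measure_solution ::
  "real \<Rightarrow> ('a::euclidean_space \<Rightarrow> real) \<Rightarrow> (real \<Rightarrow> ereal) \<Rightarrow> 'a measure \<Rightarrow>
   (real \<Rightarrow> 'a measure) \<Rightarrow> bool" where
  "weak_measure_solution T V F \<rho>0 \<rho> \<longleftrightarrow>
     AC_curve T \<rho> \<and>
     (\<forall>\<phi>. C1c \<phi> \<longrightarrow> (\<forall>t\<in>{0..T}.
        (\<integral>x. \<phi> x \<partial>\<rho> t) - (\<integral>x. \<phi> x \<partial>\<rho>0)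
          = - (LBINT s:{0..t}. (\<integral>x. grad \<phi> x \<bullet> drift V F (\<rho> s) x \<partial>\<rho> s))))"

end

theory Submission
  imports Defs
begin

text \<open>
  Since \<open>V * \<rho>\<close> takes values in a compact interval on which \<open>F'\<close> is bounded, the drift is bounded, and it
  is jointly continuous in the position and (narrowly) in the measure, by the continuity of translations
  in \<open>L\<^sup>1\<close>. It need not be Lipschitz, so a solution is obtained as in Peano's theorem: an explicit Euler
  scheme defines maps \<open>X\<^sub>n(t, x)\<close>, with the field evaluated at the push-forwards of \<open>\<rho>0\<close>. These maps need not
  be equicontinuous in \<open>x\<close>, but the laws of the trajectories are compact. Coding a trajectory, sampled at
  rational times, by one real number through a space-filling curve reduces this compactness to the
  theorems of Helly and Skorohod on the real line. On Skorohod's probability space there are starting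
  points \<open>x\<^sub>n\<close> of law \<open>\<rho>0\<close> such that \<open>X\<^sub>n(t, x\<^sub>n)\<close> converges almost surely for all \<open>t\<close>. The limit solves
  \<open>Z' = - drift\<close> along its own laws \<open>\<rho>\<^sub>t\<close>, and the joint law of \<open>(Z\<^sub>s, Z\<^sub>t)\<close> is a coupling of cost at most
  \<open>(B (t - s))\<^sup>2\<close>.
\<close>

section \<open>Coding sequences by real numbers\<close>

text \<open>Schoenberg's space-filling curve, with infinitely many coordinates: on \<open>[0,1]\<close> modulo 2, the wave
  is 0 on \<open>[0,1/3]\<close> and 1 on \<open>[2/3,1]\<close>, so it reads off ternary digits in \<open>{0,2}\<close>.\<close>

definition cantor_wave :: "real \<Rightarrow> real" where
  "cantor_wave t = max 0 (min 1 (1 / 2 - cos (pi * t)))"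

definition ternary_code :: "(nat \<Rightarrow> nat) \<Rightarrow> real" where
  "ternary_code b = (\<Sum>j. 2 * real (b j) / 3 ^ Suc j)"

definition binary_digit :: "nat \<Rightarrow> real \<Rightarrow> nat" where
  "binary_digit k x = nat (\<lfloor>2 ^ Suc k * x\<rfloor> - 2 * \<lfloor>2 ^ k * x\<rfloor>)"

text \<open>The binary digits of all coordinates are interleaved by the pairing function. Only
  measurability is claimed for this map; continuity, which carries limits, is a property of its left
  inverse \<open>cube_decode\<close> on sequences in [0,1).\<close>

definition cube_encode :: "(nat \<Rightarrow> real) \<Rightarrow> real" where
  "cube_encode c = ternary_code (\<lambda>j. binary_digit (snd (prod_decode j)) (c (fst (prod_decode j))))"

definition cube_decode :: "nat \<Rightarrow> real \<Rightarrow> real" where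
  "cube_decode i t = (\<Sum>k. cantor_wave (3 ^ prod_encode (i, k) * t) / 2 ^ Suc k)"

lemma cantor_wave_bounds: "0 \<le> cantor_wave t" "cantor_wave t \<le> 1"
  by (auto simp: cantor_wave_def)

lemma cantor_wave_periodic: "cantor_wave (2 * real n + u) = cantor_wave u"
proof -
  have "pi * (2 * real n + u) = 2 * real n * pi + pi * u"
    by (simp add: algebra_simps)
  then have "cos (pi * (2 * real n + u)) = cos (pi * u)"
    by (simp add: cos_add)
  then show ?thesis by (simp add: cantor_wave_def)
qed

text \<open>The clamp in \<open>cantor_wave\<close> absorbs all lower digits: the cosine is at least
  1/2 on the first third and at most -1/2 on the last, so 1/2 minus the cosine is at most 0 or at
  least 1 there.\<close>

lemma cantor_wave_digit:
  assumes "b \<le> 1" "0 \<le> s" "s \<le> 1"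
  shows "cantor_wave ((2 * real b + s) / 3) = real b"
proof (cases "b = 0")
  case True
  have "cos (pi / 3) \<le> cos (pi * (s / 3))"
    using assms by (intro cos_monotone_0_pi_le) (auto simp: field_simps)
  then show ?thesis using True by (simp add: cantor_wave_def cos_60)
next
  case False
  then have b: "b = 1" using assms by simp
  have "cos (pi * ((2 + s) / 3)) \<le> cos (pi - pi / 3)"
    using assms by (intro cos_monotone_0_pi_le) (auto simp: field_simps)
  then have "cos (pi * ((2 + s) / 3)) \<le> - (1 / 2)"
    by (simp only: cos_pi_minus cos_60)
  then show ?thesis using b by (simp add: cantor_wave_def)
qed

section \<open>Ternary expansions with digits 0 and 2\<close>

lemma
  assumes b: "\<And>j. b j \<le> 1"
  shows summable_ternary_code: "summable (\<lambda>j. 2 * real (b j) / 3 ^ Suc j)"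
    and ternary_code_bounds: "0 \<le> ternary_code b" "ternary_code b \<le> 1"
proof -
  have "(\<lambda>j. (2 / 3) * (1 / 3) ^ j) sums ((2 / 3) * (1 / (1 - 1 / 3 :: real)))"
    by (intro sums_mult geometric_sums) auto
  then have g: "(\<lambda>j. 2 / 3 ^ Suc j) sums (1 :: real)"
    by (simp add: power_one_over divide_simps)
  have le: "2 * real (b j) / 3 ^ Suc j \<le> 2 / 3 ^ Suc j" for j
    using b[of j] by (intro divide_right_mono) auto
  show s: "summable (\<lambda>j. 2 * real (b j) / 3 ^ Suc j)"
    by (rule summable_comparison_test'[OF sums_summable[OF g], of 0]) (use le in auto)
  show "0 \<le> ternary_code b"
    unfolding ternary_code_def by (intro suminf_nonneg s) auto
  have "ternary_code b \<le> (\<Sum>j. 2 / 3 ^ Suc j)"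
    unfolding ternary_code_def by (intro suminf_le le s sums_summable[OF g])
  then show "ternary_code b \<le> 1" using sums_unique[OF g] by simp
qed

lemma ternary_code_shift:
  assumes b: "\<And>j. b j \<le> 1"
  shows "ternary_code b = (2 * real (b 0) + ternary_code (\<lambda>j. b (Suc j))) / 3"
proof -
  have "ternary_code b = 2 * real (b 0) / 3 + (\<Sum>j. 2 * real (b (Suc j)) / 3 ^ Suc (Suc j))"
    unfolding ternary_code_def
    using suminf_split_head[OF summable_ternary_code[of b, OF b]] by simp
  also have "(\<Sum>j. 2 * real (b (Suc j)) / 3 ^ Suc (Suc j)) = ternary_code (\<lambda>j. b (Suc j)) / 3"
    unfolding ternary_code_def using b
    by (subst suminf_divide[symmetric])
       (auto intro!: summable_ternary_code[of "\<lambda>j. b (Suc j)", simplified] simp: field_simps)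
  finally show ?thesis by (simp add: add_divide_distrib)
qed

text \<open>Multiplication by \<open>3 ^ m\<close> moves the first \<open>m\<close> digits in front
  of the ternary point. They contribute an even integer, since every digit is 0 or 2, and the period
  2 of the wave removes it.\<close>

lemma cantor_wave_ternary_code:
  assumes b: "\<And>j. b j \<le> 1"
  shows "cantor_wave (3 ^ m * ternary_code b) = real (b m)"
  using b
proof (induction m arbitrary: b)
  case 0
  have "cantor_wave ((2 * real (b 0) + ternary_code (\<lambda>j. b (Suc j))) / 3) = real (b 0)"
    by (intro cantor_wave_digit ternary_code_bounds 0)
  then show ?case using ternary_code_shift[of b] 0 by (simp only: power_0 mult_1_left)
next
  case (Suc m)
  have "3 ^ Suc m * ternary_code b
      = 2 * real (3 ^ m * b 0) + 3 ^ m * ternary_code (\<lambda>j. b (Suc j))"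
    by (subst ternary_code_shift[of b, OF Suc.prems]) (simp add: field_simps)
  then show ?case
    using Suc.IH[of "\<lambda>j. b (Suc j)"] Suc.prems by (simp only: cantor_wave_periodic)
qed

section \<open>Binary expansions and the decoding identity\<close>

lemma real_binary_digit:
  "real (binary_digit k x) = of_int \<lfloor>2 ^ Suc k * x\<rfloor> - 2 * of_int \<lfloor>2 ^ k * x\<rfloor>"
  and binary_digit_le_1: "binary_digit k x \<le> 1"
proof -
  have "2 * \<lfloor>2 ^ k * x\<rfloor> \<le> \<lfloor>2 ^ Suc k * x\<rfloor>" "\<lfloor>2 ^ Suc k * x\<rfloor> \<le> 2 * \<lfloor>2 ^ k * x\<rfloor> + 1"
    by (simp_all add: mult.assoc, linarith+)
  then show "real (binary_digit k x) = of_int \<lfloor>2 ^ Suc k * x\<rfloor> - 2 * of_int \<lfloor>2 ^ k * x\<rfloor>"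
    "binary_digit k x \<le> 1"
    unfolding binary_digit_def by (auto simp: of_nat_nat)
qed

lemma binary_digit_sums:
  assumes "0 \<le> x" "x < 1"
  shows "(\<lambda>k. real (binary_digit k x) / 2 ^ Suc k) sums x"
proof -
  \<comment> \<open>Truncation to \<open>k\<close> binary places. The digit terms are its
    increments, so the series telescopes; \<open>0 \<le> x\<close> and \<open>x < 1\<close> make the
    zeroth truncation vanish.\<close>
  define a where "a k = of_int \<lfloor>2 ^ k * x\<rfloor> / (2 :: real) ^ k" for k
  have "(\<lambda>k. x - (1 / 2) ^ k) \<longlonglongrightarrow> x - 0"
    by (intro tendsto_intros) auto
  moreover have "x - (1 / 2) ^ k \<le> a k" "a k \<le> x" for k
  proof -
    have "2 ^ k * x - 1 \<le> of_int \<lfloor>2 ^ k * x\<rfloor>" "of_int \<lfloor>2 ^ k * x\<rfloor> \<le> 2 ^ k * x"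
      by linarith+
    then show "x - (1 / 2) ^ k \<le> a k" "a k \<le> x"
      unfolding a_def by (simp_all add: divide_simps power_one_over, simp_all add: algebra_simps)
  qed
  ultimately have "a \<longlonglongrightarrow> x"
    by (intro real_tendsto_sandwich[of "\<lambda>k. x - (1 / 2) ^ k" a sequentially "\<lambda>_. x"]) auto
  then have "(\<lambda>k. a (Suc k) - a k) sums (x - a 0)"
    by (rule telescope_sums)
  moreover have "a 0 = 0" using assms by (simp add: a_def floor_eq_iff)
  moreover have "a (Suc k) - a k = real (binary_digit k x) / 2 ^ Suc k" for k
    unfolding real_binary_digit a_def by (simp add: field_simps)
  ultimately show ?thesis by simp
qed

lemma cube_decode_encode:
  assumes "0 \<le> c i" "c i < 1"
  shows "cube_decode i (cube_encode c) = c i"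
  unfolding cube_decode_def cube_encode_def
  using binary_digit_sums[OF assms]
  by (subst cantor_wave_ternary_code) (auto simp: binary_digit_le_1[simplified] sums_iff)

lemma cube_encode_bounds: "0 \<le> cube_encode c" "cube_encode c \<le> 1"
  unfolding cube_encode_def by (intro ternary_code_bounds binary_digit_le_1)+

lemma continuous_on_cube_decode: "continuous_on UNIV (cube_decode i)"
proof -
  have lim: "uniform_limit UNIV
      (\<lambda>n t. \<Sum>k<n. cantor_wave (3 ^ prod_encode (i, k) * t) / 2 ^ Suc k)
      (cube_decode i) sequentially"
    unfolding cube_decode_def
  proof (rule Weierstrass_m_test)
    show "summable (\<lambda>k. 1 / 2 ^ Suc k :: real)"
      using summable_mult[OF summable_geometric[of "1 / 2 :: real"], of "1 / 2"]
      by (simp add: power_one_over divide_simps)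
    show "norm (cantor_wave (3 ^ prod_encode (i, n) * x) / 2 ^ Suc n) \<le> 1 / 2 ^ Suc n" for n x
      using cantor_wave_bounds[of "3 ^ prod_encode (i, n) * x"]
      by (simp add: divide_right_mono)
  qed
  show ?thesis
    by (rule uniform_limit_theorem[OF _ lim])
       (auto simp: cantor_wave_def intro!: always_eventually continuous_intros)
qed

lemma tendsto_cube_decode:
  "(f \<longlongrightarrow> t) G \<Longrightarrow> ((\<lambda>n. cube_decode i (f n)) \<longlongrightarrow> cube_decode i t) G"
  using continuous_on_cube_decode
  by (auto simp: continuous_on_eq_continuous_at intro: isCont_tendsto_compose)

lemma borel_measurable_cube_decode [measurable]: "cube_decode i \<in> borel_measurable borel"
  by (intro borel_measurable_continuous_onI continuous_on_cube_decode)

lemma borel_measurable_cube_encode: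
  assumes [measurable]: "\<And>i. (\<lambda>x. c x i) \<in> borel_measurable M"
  shows "(\<lambda>x. cube_encode (c x)) \<in> borel_measurable M"
  unfolding cube_encode_def ternary_code_def binary_digit_def by measurable

section \<open>Almost sure convergence with prescribed laws\<close>

text \<open>Integrals of bounded continuous functions pass to the limit, and along the sequence they
  are constant. Continuous cutoffs tending to the indicator of a closed set carry this over to its
  measure, and the closed sets are an intersection-stable generator of the Borel sets.\<close>

lemma distr_eq_limit:
  fixes X :: "nat \<Rightarrow> 'w \<Rightarrow> 'b::metric_space"
  assumes M: "prob_space M"
    and Xn [measurable]: "\<And>n. X n \<in> borel_measurable M"
    and Y [measurable]: "Y \<in> borel_measurable M"
    and law: "\<And>n. distr M borel (X n) = \<nu>"
    and lim: "AE w in M. (\<lambda>n. X n w) \<longlonglongrightarrow> Y w"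
  shows "distr M borel Y = \<nu>"
proof -
  interpret prob_space M by fact
  interpret Y: prob_space "distr M borel Y" by (rule prob_space_distr) simp
  interpret \<nu>: prob_space \<nu> unfolding law[of 0, symmetric] by (rule prob_space_distr) simp
  have sets\<nu> [measurable_cong]: "sets \<nu> = sets borel" unfolding law[of 0, symmetric] by simp
  have closed_eq: "measure (distr M borel Y) A = measure \<nu> A" if A: "closed A" for A
  \<comment> \<open>The empty set is separate: \<open>infdist x {}\<close> is 0 by convention, so
    the cutoffs would be constantly 1.\<close>
  proof (cases "A = {}")
    case False
    define \<phi> where "\<phi> k x = max 0 (1 - real k * infdist x A)" for k x
    have \<phi>_cont: "continuous_on UNIV (\<phi> k)" for k
      unfolding \<phi>_def by (intro continuous_intros)
    have \<phi>_meas [measurable]: "\<phi> k \<in> borel_measurable borel" for k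
      by (intro borel_measurable_continuous_onI \<phi>_cont)
    have \<phi>_bound: "norm (\<phi> k x) \<le> 1" for k x
      unfolding \<phi>_def by (auto simp: infdist_nonneg)
    have A_meas [measurable]: "A \<in> sets borel" using A by simp
    have \<phi>_lim: "(\<lambda>k. \<phi> k x) \<longlonglongrightarrow> indicator A x" for x
    proof (cases "x \<in> A")
      case True
      then show ?thesis by (simp add: \<phi>_def)
    next
      case False
      then have pos: "infdist x A > 0"
        using A \<open>A \<noteq> {}\<close> infdist_pos_not_in_closed by blast
      have "\<phi> k x = 0" if "k \<ge> nat \<lceil>1 / infdist x A\<rceil>" for k
      proof -
        have "1 / infdist x A \<le> real k" using that by linarith
        then show ?thesis using pos by (simp add: \<phi>_def field_simps)
      qed
      then have "eventually (\<lambda>k. \<phi> k x = 0) sequentially"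
        unfolding eventually_sequentially by blast
      then show ?thesis using False by (simp add: tendsto_eventually)
    qed
    have eq: "(\<integral>x. \<phi> k x \<partial>distr M borel Y) = (\<integral>x. \<phi> k x \<partial>\<nu>)" for k
    proof -
      have "(\<lambda>n. \<integral>w. \<phi> k (X n w) \<partial>M) \<longlonglongrightarrow> (\<integral>w. \<phi> k (Y w) \<partial>M)"
      proof (rule integral_dominated_convergence[where w="\<lambda>_. 1"])
        show "AE w in M. (\<lambda>n. \<phi> k (X n w)) \<longlonglongrightarrow> \<phi> k (Y w)"
          using lim
        proof eventually_elim
          case (elim w)
          then show ?case
            by (rule isCont_tendsto_compose[rotated])
               (use \<phi>_cont in \<open>auto simp: continuous_on_eq_continuous_at\<close>)
        qed
      qed (auto simp: \<phi>_bound intro: \<phi>_bound[simplified])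
      moreover have "(\<integral>w. \<phi> k (X n w) \<partial>M) = (\<integral>x. \<phi> k x \<partial>\<nu>)" for n
        unfolding law[of n, symmetric] by (simp add: integral_distr)
      ultimately show ?thesis by (simp add: integral_distr LIMSEQ_const_iff)
    qed
    have "(\<lambda>k. \<integral>x. \<phi> k x \<partial>N) \<longlonglongrightarrow> measure N A"
      if N: "prob_space N" and [measurable_cong]: "sets N = sets borel" for N
    proof -
      interpret N: prob_space N by (rule N)
      have "(\<lambda>k. \<integral>x. \<phi> k x \<partial>N) \<longlonglongrightarrow> (\<integral>x. indicator A x \<partial>N)"
        by (rule integral_dominated_convergence[where w="\<lambda>_. 1"])
           (auto simp: \<phi>_lim intro: \<phi>_bound[simplified])
      then show ?thesis by simp
    qed
    from this[OF Y.prob_space_axioms] this[OF \<nu>.prob_space_axioms sets\<nu>] show ?thesis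
      unfolding eq by (auto intro: LIMSEQ_unique)
  qed auto
  show ?thesis
  proof (rule measure_eqI_generator_eq[where E="Collect closed" and \<Omega>=UNIV and A="\<lambda>_. UNIV"])
    show "Int_stable (Collect closed)" by (auto simp: Int_stable_def)
    show "emeasure (distr M borel Y) A = emeasure \<nu> A" if "A \<in> Collect closed" for A
      using closed_eq[of A] that by (simp add: Y.emeasure_eq_measure \<nu>.emeasure_eq_measure)
    show "sets (distr M borel Y) = sigma_sets UNIV (Collect closed)"
      "sets \<nu> = sigma_sets UNIV (Collect closed)"
      by (simp_all add: sets\<nu> borel_eq_closed)
  qed (auto simp: Y.emeasure_eq_measure)
qed

text \<open>The values \<open>f n j x\<close> and the coordinates of \<open>x\<close> are squeezed
  into (0,1) and coded by one number \<open>W n x\<close> in [0,1]. The laws of the codes are tight,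
  Skorohod's theorem makes a subsequence of codes converge, and continuous decoding returns
  convergence of every coded quantity. No continuity of \<open>f n j\<close> enters, only
  measurability and a bound uniform in \<open>n\<close> and \<open>x\<close>.\<close>

lemma skorohod_coupling:
  fixes \<mu> :: "'a::euclidean_space measure" and f :: "nat \<Rightarrow> 'j \<Rightarrow> 'a \<Rightarrow> real"
  assumes \<mu>: "prob_space \<mu>" and sets_\<mu>: "sets \<mu> = sets borel"
    and J: "countable J"
    and f_meas: "\<And>n j. j \<in> J \<Longrightarrow> f n j \<in> borel_measurable borel"
    and f_bound: "\<And>j. j \<in> J \<Longrightarrow> \<exists>K. \<forall>n x. \<bar>f n j x\<bar> \<le> K"
  obtains r :: "nat \<Rightarrow> nat" and \<Omega> :: "real measure" and X :: "nat \<Rightarrow> real \<Rightarrow> 'a"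
      and Y :: "real \<Rightarrow> 'a"
  where "strict_mono r" "prob_space \<Omega>"
    "\<And>n. X n \<in> borel_measurable \<Omega>" "Y \<in> borel_measurable \<Omega>"
    "\<And>n. distr \<Omega> borel (X n) = \<mu>" "distr \<Omega> borel Y = \<mu>"
    "AE w in \<Omega>. (\<lambda>n. X n w) \<longlonglongrightarrow> Y w"
    "AE w in \<Omega>. \<forall>j\<in>J. convergent (\<lambda>n. f (r n) j (X n w))"
proof -
  interpret \<mu>: prob_space \<mu> by fact
  note sets_\<mu>[measurable_cong]
  \<comment> \<open>A homeomorphism of the line onto (0,1), because decoding is exact only for
    coordinates in [0,1).\<close>
  define h where "h y = 1 / 2 + arctan y / pi" for y :: real
  define hinv where "hinv z = tan (pi * (z - 1 / 2))" for z :: real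
  have hinv_h [simp]: "hinv (h y) = y" for y
    by (simp add: hinv_def h_def tan_arctan)
  have h_bounds: "0 < h y" "h y < 1" for y
    using arctan_lbound[of y] arctan_ubound[of y] by (auto simp: h_def field_simps)
  have h_meas [measurable]: "h \<in> borel_measurable borel"
    unfolding h_def by (intro borel_measurable_continuous_onI continuous_intros) auto
  have hinv_meas [measurable]: "hinv \<in> borel_measurable borel"
    unfolding hinv_def tan_def by measurable
  have hinv_cont: "isCont hinv z" if "0 < z" "z < 1" for z
  proof -
    have "0 < pi * z" "pi * z < pi" using that by simp_all
    then have "cos (pi * (z - 1 / 2)) > 0"
      by (intro cos_gt_zero_pi) (auto simp: algebra_simps)
    then show ?thesis
      unfolding hinv_def by (intro continuous_intros) auto
  qed

  \<comment> \<open>The coordinates of the starting point join the coded data, so that the point can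
    be recovered from its code by \<open>pos\<close>.\<close>
  define I :: "('j + 'a) set" where "I = J <+> Basis"
  have I: "countable I" "I \<noteq> {}"
    unfolding I_def using J by (auto intro: countable_Plus simp: countable_finite)
  define idx where "idx = to_nat_on I"
  define G where "G n i x = (case i of Inl j \<Rightarrow> f n j x | Inr b \<Rightarrow> x \<bullet> b)" for n i x
  have G_meas: "G n i \<in> borel_measurable borel" if "i \<in> I" for n i
    using that f_meas unfolding G_def I_def by (cases i) auto
  define W where "W n x = cube_encode (\<lambda>k. h (G n (from_nat_into I k) x))" for n x
  have G_meas': "(\<lambda>x. h (G n (from_nat_into I k) x)) \<in> borel_measurable borel" for n k
    using G_meas[OF from_nat_into[OF I(2)]] by measurable
  have W_meas [measurable]: "W n \<in> borel_measurable borel" for n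
    unfolding W_def by (rule borel_measurable_cube_encode) (rule G_meas')
  have W_bounds: "0 \<le> W n x" "W n x \<le> 1" for n x
    unfolding W_def by (rule cube_encode_bounds)+
  have decode_W: "cube_decode (idx i) (W n x) = h (G n i x)" if "i \<in> I" for i n x
    using that h_bounds[of "G n i x"] I
    by (simp add: W_def idx_def cube_decode_encode)
  define pos where "pos w = (\<Sum>b\<in>Basis. hinv (cube_decode (idx (Inr b)) w) *\<^sub>R b)" for w :: real
  have pos_meas [measurable]: "pos \<in> borel_measurable borel"
    unfolding pos_def by measurable
  have pos_W: "pos (W n x) = x" for n x
  proof -
    have "hinv (cube_decode (idx (Inr b)) (W n x)) = x \<bullet> b" if "b \<in> Basis" for b
      using that by (subst decode_W) (auto simp: I_def G_def)
    then show ?thesis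
      unfolding pos_def by (simp add: euclidean_representation)
  qed

  define L where "L n = distr \<mu> borel (W n)" for n
  have L_distr: "real_distribution (L n)" for n
    unfolding L_def by simp
  \<comment> \<open>Tightness is phrased with intervals open on the left, and the bounds on the
    codes allow 0, hence the left end -1.\<close>
  have L_interval: "measure (L n) {-1<..1} = 1" for n
  proof -
    have "W n -` {-1<..1} \<inter> space \<mu> = space \<mu>"
      using W_bounds[of n] by (fastforce intro: less_le_trans[of "-1 :: real" 0])
    then show ?thesis
      unfolding L_def by (subst measure_distr) (auto simp: \<mu>.prob_space)
  qed
  have "tight L"
    unfolding tight_def using L_distr
    by (intro conjI allI impI exI[of _ "-1 :: real"] exI[of _ "1 :: real"])
       (auto simp: L_interval)
  then obtain r N where r: "strict_mono r" and N: "real_distribution N"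
      "weak_conv_m (L \<circ> (\<lambda>n. n) \<circ> r) N"
    using tight_imp_convergent_subsubsequence[of L "\<lambda>n. n"] by (auto simp: strict_mono_def)
  have "weak_conv_m (\<lambda>n. L (r n)) N" using N(2) by (simp add: comp_def)
  from Skorohod[OF L_distr N(1) this] obtain \<Omega> :: "real measure" and U V
    where \<Omega>: "prob_space \<Omega>"
      and U_meas [measurable]: "\<And>n. U n \<in> borel_measurable \<Omega>"
      and U_law: "\<And>n. distr \<Omega> borel (U n) = L (r n)"
      and V_meas [measurable]: "V \<in> borel_measurable \<Omega>"
      and UV: "\<And>w. w \<in> space \<Omega> \<Longrightarrow> (\<lambda>n. U n w) \<longlonglongrightarrow> V w"
    by force
  interpret \<Omega>: prob_space \<Omega> by fact

  define X where "X n w = pos (U n w)" for n w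
  define Y where "Y w = pos (V w)" for w
  have X_meas [measurable]: "X n \<in> borel_measurable \<Omega>" for n
    unfolding X_def by measurable
  have Y_meas [measurable]: "Y \<in> borel_measurable \<Omega>"
    unfolding Y_def by measurable
  have X_law: "distr \<Omega> borel (X n) = \<mu>" for n
  proof -
    have "distr \<Omega> borel (X n) = distr (distr \<Omega> borel (U n)) borel pos"
      by (simp add: distr_distr comp_def X_def[abs_def])
    also have "\<dots> = distr \<mu> borel (\<lambda>x. x)"
      unfolding U_law L_def by (simp add: distr_distr comp_def pos_W)
    also have "\<dots> = \<mu>"
      using sets_\<mu> by (intro distr_id2) auto
    finally show ?thesis .
  qed
  \<comment> \<open>Being the code of its own decoded position is a property of the law alone. It
    holds for \<open>W (r n)\<close> under \<open>\<mu>\<close>, hence almost surely for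
    \<open>U n\<close>.\<close>
  have U_eq: "AE w in \<Omega>. U n w = W (r n) (X n w)" for n
  proof -
    have "AE u in distr \<Omega> borel (U n). u = W (r n) (pos u)"
      unfolding U_law L_def by (subst AE_distr_iff) (auto simp: pos_W)
    then show ?thesis
      by (subst (asm) AE_distr_iff) (auto simp: X_def)
  qed
  have decode_U: "AE w in \<Omega>. \<forall>n. \<forall>i\<in>I. cube_decode (idx i) (U n w) = h (G (r n) i (X n w))"
  proof -
    have "AE w in \<Omega>. \<forall>n. U n w = W (r n) (X n w)"
      using U_eq by (simp add: AE_all_countable)
    then show ?thesis
      by eventually_elim (simp add: decode_W)
  qed
  have lim: "AE w in \<Omega>. \<forall>i\<in>I. (\<lambda>n. h (G (r n) i (X n w))) \<longlonglongrightarrow> cube_decode (idx i) (V w)"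
    using decode_U AE_space
  proof eventually_elim
    case (elim w)
    show ?case
    proof
      fix i assume i: "i \<in> I"
      have "(\<lambda>n. cube_decode (idx i) (U n w)) \<longlonglongrightarrow> cube_decode (idx i) (V w)"
        by (intro tendsto_cube_decode UV elim)
      then show "(\<lambda>n. h (G (r n) i (X n w))) \<longlonglongrightarrow> cube_decode (idx i) (V w)"
        using elim i by simp
    qed
  qed
  \<comment> \<open>A limit of numbers in (0,1) could be 0 or 1, that is, a coordinate of the
    starting point could escape to infinity. This has probability 0: all \<open>X n\<close> have law
    \<open>\<mu>\<close>, so the limit of the squeezed coordinate has the law of
    \<open>h (x \<bullet> b)\<close>.\<close>
  have interior: "AE w in \<Omega>. 0 < cube_decode (idx (Inr b)) (V w) \<and> cube_decode (idx (Inr b)) (V w) < 1"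
    if b: "b \<in> Basis" for b
  proof -
    have bI: "Inr b \<in> I" using b by (auto simp: I_def)
    have "distr \<Omega> borel (\<lambda>w. cube_decode (idx (Inr b)) (V w)) = distr \<mu> borel (\<lambda>x. h (x \<bullet> b))"
    proof (rule distr_eq_limit[where X="\<lambda>n w. h (X n w \<bullet> b)"])
      show "distr \<Omega> borel (\<lambda>w. h (X n w \<bullet> b)) = distr \<mu> borel (\<lambda>x. h (x \<bullet> b))" for n
        unfolding X_law[of n, symmetric] by (simp add: distr_distr comp_def)
      show "AE w in \<Omega>. (\<lambda>n. h (X n w \<bullet> b)) \<longlonglongrightarrow> cube_decode (idx (Inr b)) (V w)"
        using lim by eventually_elim (use bI in \<open>auto simp: G_def dest!: bspec[where x="Inr b"]\<close>)
    qed (auto intro: \<Omega>)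
    moreover have "AE z in distr \<mu> borel (\<lambda>x. h (x \<bullet> b)). 0 < z \<and> z < 1"
      by (subst AE_distr_iff) (auto simp: h_bounds)
    ultimately have "AE z in distr \<Omega> borel (\<lambda>w. cube_decode (idx (Inr b)) (V w)). 0 < z \<and> z < 1"
      by (simp only:)
    then show ?thesis
      by (subst (asm) AE_distr_iff) auto
  qed
  have XY: "AE w in \<Omega>. (\<lambda>n. X n w) \<longlonglongrightarrow> Y w"
  proof -
    have "AE w in \<Omega>. \<forall>b\<in>Basis.
        0 < cube_decode (idx (Inr b)) (V w) \<and> cube_decode (idx (Inr b)) (V w) < 1"
      using interior by (intro AE_finite_allI) auto
    then show ?thesis
      using AE_space
    proof eventually_elim
      case (elim w)
      show ?case
        unfolding X_def Y_def pos_def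
        using elim
        by (intro tendsto_intros isCont_tendsto_compose[OF hinv_cont] tendsto_cube_decode UV) auto
    qed
  qed
  have conv: "AE w in \<Omega>. \<forall>j\<in>J. convergent (\<lambda>n. f (r n) j (X n w))"
    using lim
  proof eventually_elim
    case (elim w)
    show ?case
    proof
      fix j assume j: "j \<in> J"
      then obtain K where K: "\<And>n x. \<bar>f n j x\<bar> \<le> K" using f_bound by blast
      define z where "z = cube_decode (idx (Inl j)) (V w)"
      have lim_z: "(\<lambda>n. h (f (r n) j (X n w))) \<longlonglongrightarrow> z"
        using elim j by (auto simp: z_def I_def G_def dest!: bspec[where x="Inl j"])
      have h_mono: "h a \<le> h b" if "a \<le> b" for a b
        using that by (simp add: h_def divide_right_mono arctan_monotone')
      \<comment> \<open>For the data indexed by \<open>J\<close>, the uniform bound \<open>K\<close>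
        keeps the limit away from 0 and 1, where \<open>hinv\<close> is not controlled.\<close>
      have "h (- K) \<le> z"
        by (rule tendsto_lowerbound[OF lim_z])
           (use K in \<open>auto intro!: always_eventually h_mono simp: abs_le_iff minus_le_iff\<close>)
      moreover have "z \<le> h K"
        by (rule tendsto_upperbound[OF lim_z])
           (use K in \<open>auto intro!: always_eventually h_mono simp: abs_le_iff\<close>)
      ultimately have "isCont hinv z"
        using h_bounds[of K] h_bounds[of "- K"] by (intro hinv_cont) auto
      then have "(\<lambda>n. hinv (h (f (r n) j (X n w)))) \<longlonglongrightarrow> hinv z"
        by (rule isCont_tendsto_compose[OF _ lim_z])
      then show "convergent (\<lambda>n. f (r n) j (X n w))"
        by (auto simp: convergent_def)
    qed
  qed
  have Y_law: "distr \<Omega> borel Y = \<mu>"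
    by (rule distr_eq_limit[OF \<Omega> X_meas Y_meas X_law XY])
  show ?thesis
    by (rule that[OF r \<Omega> X_meas Y_meas X_law Y_law XY conv])
qed

section \<open>Euler scheme for a nonlocal field\<close>

lemma has_integral_floor_step:
  fixes g :: "nat \<Rightarrow> 'b::euclidean_space"
  assumes N: "N > 0"
  shows "((\<lambda>s. g (nat \<lfloor>s * N\<rfloor>)) has_integral (\<Sum>k<m. (1 / N) *\<^sub>R g k)) {0..real m / N}"
proof (induction m)
  case 0
  then show ?case by (simp add: has_integral_refl)
next
  case (Suc m)
  have le: "real m / N \<le> real (Suc m) / N" using N by (simp add: field_simps)
  have "((\<lambda>s. g m) has_integral (1 / N) *\<^sub>R g m) {real m / N..real (Suc m) / N}"
    using has_integral_const_real[of "g m" "real m / N" "real (Suc m) / N"] le N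
    by (simp add: diff_divide_distrib[symmetric])
  \<comment> \<open>The floor jumps at the right end point, a single point that does not affect the
    integral.\<close>
  then have "((\<lambda>s. g (nat \<lfloor>s * N\<rfloor>)) has_integral (1 / N) *\<^sub>R g m) {real m / N..real (Suc m) / N}"
  proof (rule has_integral_spike_finite[rotated 2])
    fix s assume "s \<in> {real m / N..real (Suc m) / N} - {real (Suc m) / N}"
    then have "real m \<le> s * N" "s * N < real m + 1"
      using N by (auto simp: field_simps)
    then have "\<lfloor>s * N\<rfloor> = int m" by (simp add: floor_eq_iff)
    then show "g (nat \<lfloor>s * N\<rfloor>) = g m" by simp
  qed auto
  then show ?case
    using has_integral_combine[OF _ le Suc] N by simp
qed

text \<open>Continuity is asked sequentially and jointly in law and position, with narrow
  convergence spelled out by test functions: almost sure limits of random variables provide exactly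
  this.\<close>

locale nonlocal_field =
  fixes v :: "'a::euclidean_space measure \<Rightarrow> 'a \<Rightarrow> 'a" and B :: real
  assumes v_bound: "prob_space \<rho> \<Longrightarrow> sets \<rho> = sets borel \<Longrightarrow> norm (v \<rho> x) \<le> B"
    and v_tendsto: "(\<And>n. prob_space (\<rho>s n)) \<Longrightarrow> (\<And>n. sets (\<rho>s n) = sets borel) \<Longrightarrow>
      prob_space \<rho> \<Longrightarrow> sets \<rho> = sets borel \<Longrightarrow>
      (\<And>\<phi> :: 'a \<Rightarrow> real. continuous_on UNIV \<phi> \<Longrightarrow> bounded (range \<phi>) \<Longrightarrow>
         (\<lambda>n. \<integral>y. \<phi> y \<partial>\<rho>s n) \<longlonglongrightarrow> (\<integral>y. \<phi> y \<partial>\<rho>)) \<Longrightarrow>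
      xs \<longlonglongrightarrow> y \<Longrightarrow> (\<lambda>n. v (\<rho>s n) (xs n)) \<longlonglongrightarrow> v \<rho> y"
begin

lemma B_nonneg: "0 \<le> B"
proof -
  have "norm (v (return borel 0) 0) \<le> B"
    by (rule v_bound) (auto intro: prob_space_return)
  then show ?thesis using norm_ge_zero order_trans by blast
qed

lemma v_continuous:
  assumes "prob_space \<rho>" "sets \<rho> = sets borel"
  shows "continuous_on UNIV (v \<rho>)"
  unfolding continuous_on_sequentially comp_def
  using v_tendsto[of "\<lambda>_. \<rho>" \<rho>] assms by auto

text \<open>Along a pointwise convergent sequence of random variables, the field sees both the random
  position and its law, so that a single limit passage handles the nonlinearity.\<close>

lemma v_tendsto_law:
  assumes M: "prob_space M"
    and X [measurable]: "\<And>n. X n \<in> borel_measurable M" and Y [measurable]: "Y \<in> borel_measurable M"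
    and lim: "AE w in M. (\<lambda>n. X n w) \<longlonglongrightarrow> Y w"
    and x: "x \<longlonglongrightarrow> y"
  shows "(\<lambda>n. v (distr M borel (X n)) (x n)) \<longlonglongrightarrow> v (distr M borel Y) y"
proof (rule v_tendsto)
  interpret prob_space M by fact
  show "prob_space (distr M borel (X n))" "prob_space (distr M borel Y)" for n
    by (auto intro!: prob_space_distr)
  fix \<phi> :: "'a \<Rightarrow> real"
  assume \<phi>: "continuous_on UNIV \<phi>" "bounded (range \<phi>)"
  have [measurable]: "\<phi> \<in> borel_measurable borel"
    by (intro borel_measurable_continuous_onI \<phi>)
  from \<phi>(2) obtain K where K: "\<And>z. norm (\<phi> z) \<le> K" by (auto simp: bounded_iff)
  have "(\<lambda>n. \<integral>w. \<phi> (X n w) \<partial>M) \<longlonglongrightarrow> (\<integral>w. \<phi> (Y w) \<partial>M)"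
  proof (rule integral_dominated_convergence[where w="\<lambda>_. K"])
    show "AE w in M. (\<lambda>n. \<phi> (X n w)) \<longlonglongrightarrow> \<phi> (Y w)"
      using lim
    proof eventually_elim
      case (elim w)
      then show ?case
        by (rule isCont_tendsto_compose[rotated])
           (use \<phi>(1) in \<open>auto simp: continuous_on_eq_continuous_at\<close>)
    qed
  qed (use K in auto)
  then show "(\<lambda>n. \<integral>y. \<phi> y \<partial>distr M borel (X n)) \<longlonglongrightarrow> (\<integral>y. \<phi> y \<partial>distr M borel Y)"
    by (simp add: integral_distr)
qed (use x in auto)

text \<open>The update uses only the law of the current map, so the scheme is explicit. All starting
  points advance together, since the velocity of each depends on the law of all.\<close>

primrec euler :: "'a measure \<Rightarrow> real \<Rightarrow> nat \<Rightarrow> 'a \<Rightarrow> 'a" where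
  "euler \<mu> \<tau> 0 = (\<lambda>x. x)"
| "euler \<mu> \<tau> (Suc k) =
     (\<lambda>x. euler \<mu> \<tau> k x + \<tau> *\<^sub>R v (distr \<mu> borel (euler \<mu> \<tau> k)) (euler \<mu> \<tau> k x))"

text \<open>Constant between grid times rather than interpolated: the field along the path is then a
  step function, and its integral up to a grid time is exactly the Euler sum. The step
  \<open>1 / real (Suc n)\<close> avoids a division by 0.\<close>

definition euler_path :: "'a measure \<Rightarrow> nat \<Rightarrow> real \<Rightarrow> 'a \<Rightarrow> 'a" where
  "euler_path \<mu> n t = euler \<mu> (1 / real (Suc n)) (nat \<lfloor>t * real (Suc n)\<rfloor>)"

context
  fixes \<mu> :: "'a measure"
  assumes \<mu>: "prob_space \<mu>" and sets_\<mu> [measurable_cong]: "sets \<mu> = sets borel"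
begin

interpretation \<mu>: prob_space \<mu> by (rule \<mu>)

text \<open>Continuity in \<open>x\<close> yields the measurability that makes the next push-forward
  a probability measure, to which the assumptions on \<open>v\<close> apply.\<close>

lemma euler_continuous: "continuous_on UNIV (euler \<mu> \<tau> k)"
proof (induction k)
  case 0
  then show ?case by (simp add: continuous_on_id)
next
  case (Suc k)
  have [measurable]: "euler \<mu> \<tau> k \<in> borel_measurable borel"
    by (intro borel_measurable_continuous_onI Suc)
  have "continuous_on UNIV (v (distr \<mu> borel (euler \<mu> \<tau> k)))"
    by (intro v_continuous \<mu>.prob_space_distr) auto
  then have "continuous_on UNIV (\<lambda>x. v (distr \<mu> borel (euler \<mu> \<tau> k)) (euler \<mu> \<tau> k x))"
    by (rule continuous_on_compose2[OF _ Suc]) auto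
  then show ?case
    using Suc by (auto intro!: continuous_intros)
qed

lemma euler_measurable [measurable]: "euler \<mu> \<tau> k \<in> borel_measurable borel"
  by (intro borel_measurable_continuous_onI euler_continuous)

lemma euler_path_measurable [measurable]: "euler_path \<mu> n t \<in> borel_measurable borel"
  unfolding euler_path_def by simp

lemma euler_law_bound: "norm (v (distr \<mu> borel (euler \<mu> \<tau> k)) x) \<le> B"
  by (intro v_bound \<mu>.prob_space_distr) auto

lemma euler_path_0 [simp]: "euler_path \<mu> n 0 x = x"
  by (simp add: euler_path_def)

lemma norm_euler_diff:
  assumes "0 \<le> \<tau>" "j \<le> k"
  shows "norm (euler \<mu> \<tau> k x - euler \<mu> \<tau> j x) \<le> \<tau> * B * (real k - real j)"
  using assms(2)
proof (induction k rule: dec_induct)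
  case base
  then show ?case by simp
next
  case (step k)
  have "euler \<mu> \<tau> (Suc k) x - euler \<mu> \<tau> j x
      = (euler \<mu> \<tau> k x - euler \<mu> \<tau> j x) + \<tau> *\<^sub>R v (distr \<mu> borel (euler \<mu> \<tau> k)) (euler \<mu> \<tau> k x)"
    by simp
  then have "norm (euler \<mu> \<tau> (Suc k) x - euler \<mu> \<tau> j x)
      \<le> norm (euler \<mu> \<tau> k x - euler \<mu> \<tau> j x)
        + norm (\<tau> *\<^sub>R v (distr \<mu> borel (euler \<mu> \<tau> k)) (euler \<mu> \<tau> k x))"
    by (simp only: norm_triangle_ineq)
  also have "\<dots> \<le> \<tau> * B * (real k - real j) + \<tau> * B"
    using step euler_law_bound assms(1) by (intro add_mono) (auto intro: mult_left_mono)
  finally show ?case by (simp add: algebra_simps)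
qed

lemma norm_euler_path_diff:
  assumes "0 \<le> s" "0 \<le> t"
  shows "norm (euler_path \<mu> n t x - euler_path \<mu> n s x) \<le> B * (\<bar>t - s\<bar> + 1 / real (Suc n))"
proof -
  define N where "N = real (Suc n)"
  have N: "N > 0" by (simp add: N_def)
  have *: "norm (euler_path \<mu> n t x - euler_path \<mu> n s x) \<le> B * (\<bar>t - s\<bar> + 1 / N)"
    if "0 \<le> s" "s \<le> t" for s t
  proof -
    have le: "nat \<lfloor>s * N\<rfloor> \<le> nat \<lfloor>t * N\<rfloor>"
      using that N by (intro nat_mono floor_mono mult_right_mono) auto
    \<comment> \<open>Two floors differ by at most the difference of their arguments plus 1. This
      rounding is the source of the extra \<open>1 / N\<close>.\<close>
    have "real (nat \<lfloor>t * N\<rfloor>) - real (nat \<lfloor>s * N\<rfloor>) \<le> t * N - s * N + 1"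
      using that N by (simp add: of_nat_nat) linarith
    then have "1 / N * B * (real (nat \<lfloor>t * N\<rfloor>) - real (nat \<lfloor>s * N\<rfloor>))
        \<le> 1 / N * B * (t * N - s * N + 1)"
      using N B_nonneg by (intro mult_left_mono) auto
    also have "\<dots> = B * (\<bar>t - s\<bar> + 1 / N)"
      using that N by (simp add: field_simps)
    finally have bound: "1 / N * B * (real (nat \<lfloor>t * N\<rfloor>) - real (nat \<lfloor>s * N\<rfloor>))
        \<le> B * (\<bar>t - s\<bar> + 1 / N)" .
    have "0 \<le> 1 / N" using N by simp
    from order_trans[OF norm_euler_diff[OF this le] bound] show ?thesis
      unfolding euler_path_def N_def[symmetric] .
  qed
  show ?thesis
    using *[of s t] *[of t s] assms unfolding N_def
    by (cases "s \<le> t") (auto simp: norm_minus_commute abs_minus_commute)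
qed

lemma euler_eq_sum:
  "euler \<mu> \<tau> k x = x + (\<Sum>j<k. \<tau> *\<^sub>R v (distr \<mu> borel (euler \<mu> \<tau> j)) (euler \<mu> \<tau> j x))"
  by (induction k) auto

text \<open>Up to the last grid time before \<open>t\<close> the integral equals the Euler sum. The
  error is the integral over the remaining incomplete step, of length at most
  \<open>1 / real (Suc n)\<close>.\<close>

lemma
  fixes n t x
  assumes t: "0 \<le> t"
  defines "g \<equiv> \<lambda>s. v (distr \<mu> borel (euler_path \<mu> n s)) (euler_path \<mu> n s x)"
  shows euler_path_integrable: "g integrable_on {0..t}"
    and euler_path_integral:
      "norm (x + integral {0..t} g - euler_path \<mu> n t x) \<le> B / real (Suc n)"
proof -
  define N where "N = real (Suc n)"
  define m where "m = nat \<lfloor>t * N\<rfloor>"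
  define w where "w k = v (distr \<mu> borel (euler \<mu> (1 / N) k)) (euler \<mu> (1 / N) k x)" for k
  have N: "N > 0" by (simp add: N_def)
  have g: "g = (\<lambda>s. w (nat \<lfloor>s * N\<rfloor>))"
    by (simp add: g_def w_def euler_path_def N_def)
  have m: "0 \<le> real m / N" "real m / N \<le> t" "t \<le> real (Suc m) / N" "t - real m / N \<le> 1 / N"
  proof -
    have "real m \<le> t * N" "t * N \<le> real m + 1"
      unfolding m_def using t N by (simp_all add: of_nat_nat)
    then show "real m / N \<le> t" "t \<le> real (Suc m) / N"
      using N by (simp_all add: field_simps)
    then show "t - real m / N \<le> 1 / N"
      by (simp add: add_divide_distrib)
  qed (use N in auto)
  \<comment> \<open>Integrability is taken up to the next grid time, since \<open>t\<close> may lie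
    strictly between two of them.\<close>
  have "g integrable_on {0..real (Suc m) / N}"
    unfolding g using has_integral_floor_step[OF N] by (rule has_integral_integrable)
  then show int: "g integrable_on {0..t}"
    by (rule integrable_subinterval_real) (use m in auto)
  have "integral {0..real m / N} g = (\<Sum>k<m. (1 / N) *\<^sub>R w k)"
    unfolding g using has_integral_floor_step[OF N] by (rule integral_unique)
  moreover have "euler_path \<mu> n t x = x + (\<Sum>k<m. (1 / N) *\<^sub>R w k)"
    unfolding euler_path_def N_def[symmetric] m_def[symmetric] w_def by (rule euler_eq_sum)
  moreover have "integral {0..t} g = integral {0..real m / N} g + integral {real m / N..t} g"
    using Henstock_Kurzweil_Integration.integral_combine[OF m(1,2) int] by simp
  ultimately have "x + integral {0..t} g - euler_path \<mu> n t x = integral {real m / N..t} g"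
    by simp
  moreover have "norm (integral {real m / N..t} g) \<le> B * (t - real m / N)"
  proof -
    have "g integrable_on {real m / N..t}"
      by (rule integrable_subinterval_real[OF int]) (use m in auto)
    then have "(g has_integral integral {real m / N..t} g) (cbox (real m / N) t)"
      by (simp add: integrable_integral)
    from has_integral_bound[OF B_nonneg this] show ?thesis
      using m by (simp add: g w_def euler_law_bound)
  qed
  moreover have "B * (t - real m / N) \<le> B * (1 / N)"
    using m B_nonneg by (intro mult_left_mono)
  ultimately show "norm (x + integral {0..t} g - euler_path \<mu> n t x) \<le> B / real (Suc n)"
    unfolding N_def by simp
qed

end

end

context nonlocal_field
begin

text \<open>On Skorohod's space, random starting points make the Euler paths converge at rational
  times, and the Lipschitz bound up to the mesh size extends this to all times. As the starting
  points still have law \<open>\<mu>\<close>, the field sees the laws of the converging paths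
  themselves, so the Euler integral equation passes to the limit.\<close>

lemma limit_process:
  fixes \<mu> :: "'a measure"
  assumes \<mu>: "prob_space \<mu>" and sets_\<mu>: "sets \<mu> = sets borel"
  obtains \<Omega> :: "real measure" and Z :: "real \<Rightarrow> real \<Rightarrow> 'a"
  where "prob_space \<Omega>" "\<And>t. Z t \<in> borel_measurable \<Omega>" "distr \<Omega> borel (Z 0) = \<mu>"
    "AE w in \<Omega>. \<forall>s\<ge>0. \<forall>t\<ge>0. norm (Z t w - Z s w) \<le> B * \<bar>t - s\<bar>"
    "AE w in \<Omega>. \<forall>t\<ge>0. Z t w = Z 0 w + integral {0..t} (\<lambda>s. v (distr \<Omega> borel (Z s)) (Z s w))"
proof -
  note [measurable] = euler_path_measurable[OF \<mu> sets_\<mu>]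
  note path_0 = euler_path_0[OF \<mu> sets_\<mu>]
  note path_diff = norm_euler_path_diff[OF \<mu> sets_\<mu>]
  define J :: "(real \<times> 'a) set" where "J = (\<rat> \<inter> {0..}) \<times> Basis"
  \<comment> \<open>Displacements rather than positions: they are bounded uniformly in
    \<open>n\<close> and \<open>x\<close>, as \<open>skorohod_coupling\<close> requires.\<close>
  define f where "f n j x = (euler_path \<mu> n (fst j) x - x) \<bullet> snd j" for n j x
  have J: "countable J"
    unfolding J_def by (intro countable_SIGMA countable_Int1 countable_rat) (simp add: countable_finite)
  have f_meas: "f n j \<in> borel_measurable borel" for n j
    unfolding f_def by measurable
  have f_bound: "\<exists>K. \<forall>n x. \<bar>f n j x\<bar> \<le> K" if "j \<in> J" for j
  proof (intro exI allI)
    fix n x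
    obtain q b where j: "j = (q, b)" "0 \<le> q" "b \<in> Basis"
      using \<open>j \<in> J\<close> by (cases j) (auto simp: J_def)
    have "\<bar>f n j x\<bar> \<le> norm (euler_path \<mu> n q x - euler_path \<mu> n 0 x)"
      unfolding f_def j path_0 fst_conv snd_conv by (rule Basis_le_norm[OF j(3)])
    also have "\<dots> \<le> B * (\<bar>q - 0\<bar> + 1 / real (Suc n))"
      using j by (intro path_diff) auto
    also have "\<dots> \<le> B * (q + 1)"
      using B_nonneg j by (intro mult_left_mono) auto
    finally show "\<bar>f n j x\<bar> \<le> B * (fst j + 1)" by (simp add: j)
  qed
  obtain r :: "nat \<Rightarrow> nat" and \<Omega> :: "real measure" and X Y
    where r: "strict_mono r" and \<Omega>: "prob_space \<Omega>"
      and X_meas [measurable]: "\<And>n. X n \<in> borel_measurable \<Omega>"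
      and Y_meas [measurable]: "Y \<in> borel_measurable \<Omega>"
      and X_law: "\<And>n. distr \<Omega> borel (X n) = \<mu>" and Y_law: "distr \<Omega> borel Y = \<mu>"
      and XY: "AE w in \<Omega>. (\<lambda>n. X n w) \<longlonglongrightarrow> Y w"
      and conv: "AE w in \<Omega>. \<forall>j\<in>J. convergent (\<lambda>n. f (r n) j (X n w))"
    by (rule skorohod_coupling[of \<mu> J f, OF \<mu> sets_\<mu> J f_meas f_bound]) (assumption, rule that)
  interpret \<Omega>: prob_space \<Omega> by (rule \<Omega>)
  define P where "P n t w = euler_path \<mu> (r n) t (X n w)" for n t w
  have P_meas [measurable]: "P n t \<in> borel_measurable \<Omega>" for n t
    unfolding P_def by measurable
  have inv_0: "(\<lambda>n. 1 / real (Suc (r n))) \<longlonglongrightarrow> 0"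
    using LIMSEQ_subseq_LIMSEQ[OF LIMSEQ_inverse_real_of_nat r]
    by (simp add: comp_def inverse_eq_divide)
  have P_0: "P n 0 w = X n w" for n w
    by (simp add: P_def path_0)
  have P_diff: "norm (P n t w - P n s w) \<le> B * (\<bar>t - s\<bar> + 1 / real (Suc (r n)))"
    if "0 \<le> s" "0 \<le> t" for n s t w
    unfolding P_def using that by (rule path_diff)

  \<comment> \<open>\<open>lim\<close> is unspecified where the sequence diverges; for nonnegative
    times this happens only on one common null set, by \<open>PZ\<close>.\<close>
  define Z where "Z t w = lim (\<lambda>n. P n t w)" for t w
  have Z_meas [measurable]: "Z t \<in> borel_measurable \<Omega>" for t
    unfolding Z_def by measurable
  \<comment> \<open>The countably many rational times come from the coupling. All other times follow
    for the same \<open>w\<close>, so one null set serves an uncountable family.\<close>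
  have PZ: "AE w in \<Omega>. \<forall>t\<ge>0. (\<lambda>n. P n t w) \<longlonglongrightarrow> Z t w"
    using XY conv
  proof eventually_elim
    case (elim w)
    have rat: "convergent (\<lambda>n. P n q w)" if q: "q \<in> \<rat>" "0 \<le> q" for q
    proof -
      have "P n q w = X n w + (\<Sum>b\<in>Basis. f (r n) (q, b) (X n w) *\<^sub>R b)" for n
        by (simp add: P_def f_def euclidean_representation)
      moreover have "(\<lambda>n. X n w + (\<Sum>b\<in>Basis. f (r n) (q, b) (X n w) *\<^sub>R b)) \<longlonglongrightarrow>
          Y w + (\<Sum>b\<in>Basis. lim (\<lambda>n. f (r n) (q, b) (X n w)) *\<^sub>R b)"
        using elim q by (intro tendsto_intros) (auto simp: convergent_LIMSEQ_iff[symmetric] J_def)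
      ultimately show ?thesis by (auto simp: convergent_def)
    qed
    show ?case
    proof (intro allI impI)
      fix t :: real assume t: "0 \<le> t"
      have "Cauchy (\<lambda>n. P n t w)"
      proof (rule CauchyI)
        fix e :: real assume e: "0 < e"
        \<comment> \<open>Distance below \<open>d\<close> to a rational time and mesh below
          \<open>d\<close> together cost at most \<open>B * (2 * d) \<le> e / 3\<close>. The summand
          1 in the denominator covers \<open>B = 0\<close>.\<close>
        define d where "d = e / (6 * (B + 1))"
        have d: "0 < d" unfolding d_def using e B_nonneg by simp
        have Bd: "B * (2 * d) \<le> e / 3"
          unfolding d_def using e B_nonneg by (simp add: field_simps)
        obtain q where q: "q \<in> \<rat>" "t < q" "q < t + d"
          using Rats_dense_in_real[of t "t + d"] d by auto
        have "Cauchy (\<lambda>n. P n q w)"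
          using rat[of q] q t by (intro convergent_Cauchy) auto
        then obtain N1 where N1: "\<And>m n. m \<ge> N1 \<Longrightarrow> n \<ge> N1 \<Longrightarrow> norm (P m q w - P n q w) < e / 3"
          using CauchyD[of "\<lambda>n. P n q w" "e / 3"] e by auto
        have "eventually (\<lambda>n. 1 / real (Suc (r n)) < d) sequentially"
          using inv_0 d by (rule order_tendstoD)
        then obtain N2 where N2: "\<And>n. n \<ge> N2 \<Longrightarrow> 1 / real (Suc (r n)) < d"
          by (auto simp: eventually_sequentially)
        have close: "norm (P n t w - P n q w) \<le> e / 3" if "n \<ge> N2" for n
        proof -
          have "norm (P n t w - P n q w) \<le> B * (\<bar>t - q\<bar> + 1 / real (Suc (r n)))"
            using t q by (intro P_diff) auto
          also have "\<dots> \<le> B * (2 * d)"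
            using N2[OF that] q B_nonneg by (intro mult_left_mono) auto
          finally show ?thesis using Bd by simp
        qed
        show "\<exists>M. \<forall>m\<ge>M. \<forall>n\<ge>M. norm (P m t w - P n t w) < e"
        proof (intro exI allI impI)
          fix m n assume mn: "m \<ge> max N1 N2" "n \<ge> max N1 N2"
          have "norm (P m t w - P n t w)
              = norm ((P m t w - P m q w) + (P m q w - P n q w) - (P n t w - P n q w))"
            by simp
          also have "\<dots> \<le> norm (P m t w - P m q w) + norm (P m q w - P n q w)
              + norm (P n t w - P n q w)"
            by (rule order_trans[OF norm_triangle_ineq4 add_right_mono[OF norm_triangle_ineq]])
          finally show "norm (P m t w - P n t w) < e"
            using close[of m] close[of n] N1[of m n] mn by simp
        qed
      qed
      then show "(\<lambda>n. P n t w) \<longlonglongrightarrow> Z t w"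
        unfolding Z_def by (simp add: Cauchy_convergent_iff convergent_LIMSEQ_iff)
    qed
  qed
  have Z_lip: "AE w in \<Omega>. \<forall>s\<ge>0. \<forall>t\<ge>0. norm (Z t w - Z s w) \<le> B * \<bar>t - s\<bar>"
    using PZ
  proof eventually_elim
    case (elim w)
    show ?case
    proof (intro allI impI)
      fix s t :: real assume st: "0 \<le> s" "0 \<le> t"
      have "(\<lambda>n. norm (P n t w - P n s w)) \<longlonglongrightarrow> norm (Z t w - Z s w)"
        using elim st by (intro tendsto_intros) auto
      moreover have "(\<lambda>n. B * (\<bar>t - s\<bar> + 1 / real (Suc (r n)))) \<longlonglongrightarrow> B * (\<bar>t - s\<bar> + 0)"
        by (intro tendsto_intros inv_0)
      ultimately show "norm (Z t w - Z s w) \<le> B * \<bar>t - s\<bar>"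
        using P_diff[OF st] by (auto intro: LIMSEQ_le)
    qed
  qed

  \<comment> \<open>The scheme evaluates the field at push-forwards of \<open>\<mu>\<close>; since
    \<open>X n\<close> has law \<open>\<mu>\<close>, these are the laws of \<open>P n t\<close> on
    the new probability space.\<close>
  have law: "distr \<mu> borel (euler_path \<mu> (r n) t) = distr \<Omega> borel (P n t)" for n t
    unfolding P_def[abs_def] by (subst X_law[of n, symmetric]) (simp add: distr_distr comp_def)
  define V where "V n s w = v (distr \<mu> borel (euler_path \<mu> (r n) s)) (P n s w)" for n s w
  have V_lim: "AE w in \<Omega>. \<forall>s\<ge>0. (\<lambda>n. V n s w) \<longlonglongrightarrow> v (distr \<Omega> borel (Z s)) (Z s w)"
    using PZ
  proof eventually_elim
    case (elim w)
    show ?case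
    proof (intro allI impI)
      fix s :: real assume s: "0 \<le> s"
      have "AE w in \<Omega>. (\<lambda>n. P n s w) \<longlonglongrightarrow> Z s w"
        using PZ s by auto
      then show "(\<lambda>n. V n s w) \<longlonglongrightarrow> v (distr \<Omega> borel (Z s)) (Z s w)"
        unfolding V_def law using elim s by (intro v_tendsto_law[OF \<Omega>]) auto
    qed
  qed
  have integral_eq: "AE w in \<Omega>. \<forall>t\<ge>0. Z t w
      = Y w + integral {0..t} (\<lambda>s. v (distr \<Omega> borel (Z s)) (Z s w))"
    using PZ V_lim XY
  proof eventually_elim
    case (elim w)
    show ?case
    proof (intro allI impI)
      fix t :: real assume t: "0 \<le> t"
      have "(\<lambda>n. integral {0..t} (\<lambda>s. V n s w)) \<longlonglongrightarrow>
          integral {0..t} (\<lambda>s. v (distr \<Omega> borel (Z s)) (Z s w))"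
      proof (rule dominated_convergence(2)[where h="\<lambda>_. B"])
        show "(\<lambda>s. V n s w) integrable_on {0..t}" for n
          unfolding V_def P_def by (rule euler_path_integrable[OF \<mu> sets_\<mu> t])
        show "norm (V n s w) \<le> B" for n s
          unfolding V_def law by (intro v_bound \<Omega>.prob_space_distr) auto
      qed (use elim in auto)
      then have "(\<lambda>n. X n w + integral {0..t} (\<lambda>s. V n s w)) \<longlonglongrightarrow>
          Y w + integral {0..t} (\<lambda>s. v (distr \<Omega> borel (Z s)) (Z s w))"
        using elim by (intro tendsto_intros)
      moreover have "(\<lambda>n. (X n w + integral {0..t} (\<lambda>s. V n s w)) - P n t w) \<longlonglongrightarrow> 0"
      proof (rule Lim_null_comparison[OF always_eventually])
        show "\<forall>n. norm ((X n w + integral {0..t} (\<lambda>s. V n s w)) - P n t w)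
            \<le> B * (1 / real (Suc (r n)))"
          unfolding V_def P_def using euler_path_integral[OF \<mu> sets_\<mu> t] by simp
        show "(\<lambda>n. B * (1 / real (Suc (r n)))) \<longlonglongrightarrow> 0"
          using tendsto_mult_left[OF inv_0, of B] by simp
      qed
      ultimately have "(\<lambda>n. P n t w) \<longlonglongrightarrow>
          Y w + integral {0..t} (\<lambda>s. v (distr \<Omega> borel (Z s)) (Z s w))"
        by (rule Lim_transform2)
      then show "Z t w = Y w + integral {0..t} (\<lambda>s. v (distr \<Omega> borel (Z s)) (Z s w))"
        using elim t by (blast intro: LIMSEQ_unique)
    qed
  qed
  have Z_0: "AE w in \<Omega>. Z 0 w = Y w"
    using integral_eq by eventually_elim (auto dest!: spec[where x=0])
  have Z_law: "distr \<Omega> borel (Z 0) = \<mu>"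
    unfolding Y_law[symmetric] using Z_0 by (intro distr_cong_AE) auto
  have Z_eq: "AE w in \<Omega>. \<forall>t\<ge>0. Z t w
      = Z 0 w + integral {0..t} (\<lambda>s. v (distr \<Omega> borel (Z s)) (Z s w))"
    using integral_eq Z_0 by eventually_elim simp
  show ?thesis
    by (rule that[OF \<Omega> Z_meas Z_law Z_lip Z_eq])
qed

end

section \<open>From the limit process to a weak solution\<close>

lemma grad_eqI:
  fixes f :: "'a::euclidean_space \<Rightarrow> real"
  assumes D: "GDERIV f x :> D"
  shows "grad f x = D"
  unfolding grad_def
proof (rule the_equality)
  fix D' assume "GDERIV f x :> D'"
  then have eq: "(\<lambda>h. h \<bullet> D') = (\<lambda>h. h \<bullet> D)"
    using D unfolding gderiv_def by (rule has_derivative_unique)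
  show "D' = D"
    by (rule vector_eq_ldot[THEN iffD1]) (intro allI, rule fun_cong[OF eq])
qed (rule D)

lemma GDERIV_grad:
  fixes f :: "'a::euclidean_space \<Rightarrow> real"
  assumes "f differentiable (at x)"
  shows "GDERIV f x :> grad f x"
proof -
  obtain f' where f': "(f has_derivative f') (at x)"
    using assms by (auto simp: differentiable_def)
  interpret bounded_linear f' using f' by (rule has_derivative_bounded_linear)
  define D where "D = (\<Sum>b\<in>Basis. f' b *\<^sub>R b)"
  have "f' h = h \<bullet> D" for h
  proof -
    have "f' h = f' (\<Sum>b\<in>Basis. (h \<bullet> b) *\<^sub>R b)" by (simp add: euclidean_representation)
    also have "\<dots> = h \<bullet> D" by (simp add: sum scaleR D_def inner_sum_right mult.commute)
    finally show ?thesis .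
  qed
  then have "f' = (\<lambda>h. h \<bullet> D)" by blast
  then have "GDERIV f x :> D"
    using f' unfolding gderiv_def by simp
  with grad_eqI[OF this] show ?thesis by simp
qed

lemma C1c_bounded:
  fixes f :: "'a::euclidean_space \<Rightarrow> real"
  assumes f: "C1c f"
  shows "\<exists>K. \<forall>x. \<bar>f x\<bar> \<le> K" "\<exists>K. \<forall>x. norm (grad f x) \<le> K"
proof -
  define S where "S = closure {x. f x \<noteq> 0}"
  have S: "compact S" "closed S" using f by (auto simp: C1c_def S_def)
  have diff: "f differentiable (at x)" for x using f by (auto simp: C1c_def C1_def)
  have cont: "continuous_on S f"
    using diff by (intro continuous_at_imp_continuous_on ballI differentiable_imp_continuous_within)
  have cont_grad: "continuous_on S (grad f)"
    using f by (auto simp: C1c_def C1_def intro: continuous_on_subset)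
  have zero: "f x = 0" if "x \<notin> S" for x
    using that closure_subset[of "{x. f x \<noteq> 0}"] by (auto simp: S_def)
  have "grad f x = 0" if x: "x \<notin> S" for x
  proof (rule grad_eqI)
    have "((\<lambda>_. 0 :: real) has_derivative (\<lambda>h. h \<bullet> 0)) (at x)" by simp
    then show "GDERIV f x :> 0"
      unfolding gderiv_def
      by (rule has_derivative_transform_within_open[of _ _ x UNIV "- S"]) (use S x zero in auto)
  qed
  moreover obtain K where "\<And>x. x \<in> S \<Longrightarrow> norm (grad f x) \<le> K"
    using compact_imp_bounded[OF compact_continuous_image[OF cont_grad S(1)]]
    by (auto simp: bounded_iff)
  ultimately have "norm (grad f x) \<le> max 0 K" for x by (cases "x \<in> S") (auto simp: le_max_iff_disj)
  then show "\<exists>K. \<forall>x. norm (grad f x) \<le> K" by blast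
  obtain K where "\<And>x. x \<in> S \<Longrightarrow> norm (f x) \<le> K"
    using compact_imp_bounded[OF compact_continuous_image[OF cont S(1)]]
    by (auto simp: bounded_iff)
  then have "\<bar>f x\<bar> \<le> max 0 K" for x using zero[of x] by (cases "x \<in> S") (auto simp: le_max_iff_disj)
  then show "\<exists>K. \<forall>x. \<bar>f x\<bar> \<le> K" by blast
qed

text \<open>The joint law of the two variables is a coupling whose cost is at most
  \<open>c\<^sup>2\<close>. All costs are nonnegative, so the real infimum does lie below
  it.\<close>

lemma dW_le_distr:
  fixes X Y :: "'w \<Rightarrow> 'a::euclidean_space"
  assumes M: "prob_space M"
    and X [measurable]: "X \<in> borel_measurable M" and Y [measurable]: "Y \<in> borel_measurable M"
    and le: "AE w in M. norm (Y w - X w) \<le> c"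
  shows "dW (distr M borel X) (distr M borel Y) \<le> c"
proof -
  interpret prob_space M by fact
  have "AE w in M. 0 \<le> c"
    using le by eventually_elim (rule order_trans[OF norm_ge_zero])
  then have c: "0 \<le> c" by simp
  define \<pi> where "\<pi> = distr M borel (\<lambda>w. (X w, Y w))"
  have [measurable]: "(\<lambda>w. (X w, Y w)) \<in> borel_measurable M" by simp
  have [measurable]: "(fst :: 'a \<times> 'a \<Rightarrow> 'a) \<in> borel_measurable borel"
      "(snd :: 'a \<times> 'a \<Rightarrow> 'a) \<in> borel_measurable borel"
    by (intro borel_measurable_continuous_onI continuous_intros)+
  have \<pi>: "\<pi> \<in> couplings (distr M borel X) (distr M borel Y)"
    by (simp add: couplings_def \<pi>_def distr_distr comp_def)
  let ?J = "\<lambda>\<pi> :: ('a \<times> 'a) measure. \<integral>z. (dist (fst z) (snd z))\<^sup>2 \<partial>\<pi>"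
  have "(INF \<pi>\<in>couplings (distr M borel X) (distr M borel Y). ?J \<pi>) \<le> ?J \<pi>"
    by (rule cINF_lower[OF _ \<pi>]) (auto intro!: bdd_belowI[where m=0])
  also have "?J \<pi> = (\<integral>w. (dist (X w) (Y w))\<^sup>2 \<partial>M)"
    unfolding \<pi>_def by (simp add: integral_distr)
  also have "\<dots> \<le> (\<integral>w. c\<^sup>2 \<partial>M)"
  proof (rule integral_mono_AE')
    show "AE w in M. (dist (X w) (Y w))\<^sup>2 \<le> c\<^sup>2"
      using le by eventually_elim (auto intro!: power_mono simp: dist_norm norm_minus_commute)
  qed auto
  also have "\<dots> = c\<^sup>2" by (simp add: prob_space)
  finally show ?thesis
    unfolding dW_def using c by (simp add: real_le_lsqrt)
qed

context nonlocal_field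
begin

text \<open>With \<open>\<rho> t\<close> the law of \<open>Z t\<close>, every claim becomes one
  about paths: the weak equation is the chain rule for \<open>\<phi>\<close> along a path, averaged
  over the probability space.\<close>

theorem weak_solution_exists:
  fixes \<mu> :: "'a measure"
  assumes \<mu>: "\<mu> \<in> P2"
  obtains \<rho> :: "real \<Rightarrow> 'a measure"
  where "\<rho> 0 = \<mu>" "\<And>T. AC_curve T \<rho>"
    "\<And>\<phi> t. C1c \<phi> \<Longrightarrow> 0 \<le> t \<Longrightarrow>
      (\<integral>x. \<phi> x \<partial>\<rho> t) - (\<integral>x. \<phi> x \<partial>\<mu>)
        = (LBINT s:{0..t}. (\<integral>x. grad \<phi> x \<bullet> v (\<rho> s) x \<partial>\<rho> s))"
proof -
  have \<mu>': "prob_space \<mu>" "sets \<mu> = sets borel" "integrable \<mu> (\<lambda>x. (norm x)\<^sup>2)"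
    using \<mu> by (auto simp: P2_def)
  obtain \<Omega> :: "real measure" and Z :: "real \<Rightarrow> real \<Rightarrow> 'a"
    where \<Omega>: "prob_space \<Omega>" and Z_meas [measurable]: "\<And>t. Z t \<in> borel_measurable \<Omega>"
      and Z_law: "distr \<Omega> borel (Z 0) = \<mu>"
      and Z_lip: "AE w in \<Omega>. \<forall>s\<ge>0. \<forall>t\<ge>0. norm (Z t w - Z s w) \<le> B * \<bar>t - s\<bar>"
      and Z_eq: "AE w in \<Omega>. \<forall>t\<ge>0. Z t w
        = Z 0 w + integral {0..t} (\<lambda>s. v (distr \<Omega> borel (Z s)) (Z s w))"
    by (rule limit_process[OF \<mu>'(1,2)]) (rule that)
  interpret \<Omega>: prob_space \<Omega> by (rule \<Omega>)
  define \<rho> where "\<rho> t = distr \<Omega> borel (Z t)" for t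
  have \<rho>_prob: "prob_space (\<rho> t)" and \<rho>_sets: "sets (\<rho> t) = sets borel" for t
    unfolding \<rho>_def by (auto intro!: \<Omega>.prob_space_distr)
  have \<rho>_0: "\<rho> 0 = \<mu>" by (simp add: \<rho>_def Z_law)
  have \<rho>_integral: "(\<integral>x. h x \<partial>\<rho> t) = (\<integral>w. h (Z t w) \<partial>\<Omega>)"
    if "h \<in> borel_measurable borel" for h :: "'a \<Rightarrow> real" and t
    unfolding \<rho>_def using that by (simp add: integral_distr)
  have v_meas [measurable]: "v (\<rho> t) \<in> borel_measurable borel" for t
    by (intro borel_measurable_continuous_onI v_continuous \<rho>_prob \<rho>_sets)

  \<comment> \<open>The null set is chosen before times and sequences, so that a fixed path is
    continuous at all nonnegative times at once.\<close>
  have Z_conv: "AE w in \<Omega>. \<forall>t\<ge>0. \<forall>X. (\<forall>n. 0 \<le> X n) \<longrightarrow> X \<longlonglongrightarrow> t \<longrightarrow> (\<lambda>n. Z (X n) w) \<longlonglongrightarrow> Z t w"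
    using Z_lip
  proof eventually_elim
    case (elim w)
    show ?case
    proof (intro allI impI)
      fix t :: real and X :: "nat \<Rightarrow> real"
      assume t: "0 \<le> t" and X: "\<forall>n. 0 \<le> X n" "X \<longlonglongrightarrow> t"
      have lim: "(\<lambda>n. B * \<bar>X n - t\<bar>) \<longlonglongrightarrow> B * \<bar>t - t\<bar>"
        by (intro tendsto_intros X)
      have le: "norm (Z (X n) w - Z t w) \<le> B * \<bar>X n - t\<bar>" for n
        using elim[rule_format, of t "X n"] t X by simp
      have "(\<lambda>n. Z (X n) w - Z t w) \<longlonglongrightarrow> 0"
        by (rule Lim_null_comparison[OF always_eventually]) (use le lim in auto)
      then show "(\<lambda>n. Z (X n) w) \<longlonglongrightarrow> Z t w" by (rule LIM_zero_cancel)
    qed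
  qed
  have v_conv: "AE w in \<Omega>. \<forall>t\<ge>0. \<forall>X. (\<forall>n. 0 \<le> X n) \<longrightarrow> X \<longlonglongrightarrow> t
      \<longrightarrow> (\<lambda>n. v (\<rho> (X n)) (Z (X n) w)) \<longlonglongrightarrow> v (\<rho> t) (Z t w)"
    using Z_conv
  proof eventually_elim
    case (elim w)
    show ?case
    proof (intro allI impI)
      fix t :: real and X :: "nat \<Rightarrow> real"
      assume t: "0 \<le> t" and X: "\<forall>n. 0 \<le> X n" "X \<longlonglongrightarrow> t"
      \<comment> \<open>The laws converge because almost every path does; the fixed path is used
        separately, to supply the position.\<close>
      have "AE w in \<Omega>. (\<lambda>n. Z (X n) w) \<longlonglongrightarrow> Z t w"
        using Z_conv
      proof eventually_elim
        case (elim w)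
        show ?case by (rule elim[rule_format]) (use t X in auto)
      qed
      moreover have "(\<lambda>n. Z (X n) w) \<longlonglongrightarrow> Z t w"
        by (rule elim[rule_format]) (use t X in auto)
      ultimately show "(\<lambda>n. v (\<rho> (X n)) (Z (X n) w)) \<longlonglongrightarrow> v (\<rho> t) (Z t w)"
        unfolding \<rho>_def by (rule v_tendsto_law[OF \<Omega> Z_meas Z_meas])
    qed
  qed
  have Z_deriv: "AE w in \<Omega>. \<forall>t\<in>{0..T}. ((\<lambda>s. Z s w) has_vector_derivative v (\<rho> t) (Z t w)) (at t within {0..T})"
    for T
    using v_conv Z_eq
  proof eventually_elim
    case (elim w)
    \<comment> \<open>Continuity of the field along the path upgrades the integral equation to a
      derivative at every time.\<close>
    have cont: "continuous_on {0..T} (\<lambda>s. v (\<rho> s) (Z s w))"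
      unfolding continuous_on_sequentially comp_def
    proof (intro allI ballI impI)
      fix X t assume "t \<in> {0..T}" "(\<forall>n. X n \<in> {0..T}) \<and> X \<longlonglongrightarrow> t"
      then show "(\<lambda>n. v (\<rho> (X n)) (Z (X n) w)) \<longlonglongrightarrow> v (\<rho> t) (Z t w)"
        by (intro elim(1)[rule_format]) auto
    qed
    show ?case
    proof
      fix t assume t: "t \<in> {0..T}"
      have "((\<lambda>u. Z 0 w + integral {0..u} (\<lambda>s. v (\<rho> s) (Z s w))) has_vector_derivative
          0 + v (\<rho> t) (Z t w)) (at t within {0..T})"
        by (intro has_vector_derivative_add has_vector_derivative_const
            integral_has_vector_derivative cont t)
      then show "((\<lambda>s. Z s w) has_vector_derivative v (\<rho> t) (Z t w)) (at t within {0..T})"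
        unfolding add_0
      proof (rule has_vector_derivative_transform[OF t, rotated])
        show "Z u w = Z 0 w + integral {0..u} (\<lambda>s. v (\<rho> s) (Z s w))" if "u \<in> {0..T}" for u
          unfolding \<rho>_def by (rule elim(2)[rule_format]) (use that in simp)
      qed
    qed
  qed

  have weak: "(\<integral>x. \<phi> x \<partial>\<rho> T) - (\<integral>x. \<phi> x \<partial>\<mu>)
        = (LBINT s:{0..T}. (\<integral>x. grad \<phi> x \<bullet> v (\<rho> s) x \<partial>\<rho> s))"
    if \<phi>: "C1c \<phi>" and T: "0 \<le> T" for \<phi> T
  proof -
    obtain K1 where K1: "\<And>x. \<bar>\<phi> x\<bar> \<le> K1" using C1c_bounded(1)[OF \<phi>] by blast
    obtain K2 where K2: "\<And>x. norm (grad \<phi> x) \<le> K2" using C1c_bounded(2)[OF \<phi>] by blast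
    have K2_nonneg: "0 \<le> K2" using K2[of 0] norm_ge_zero order_trans by blast
    have \<phi>_diff: "\<phi> differentiable (at x)" and grad_cont: "continuous_on UNIV (grad \<phi>)" for x
      using \<phi> by (auto simp: C1c_def C1_def)
    have \<phi>_deriv: "(\<phi> has_derivative (\<lambda>h. h \<bullet> grad \<phi> x)) (at x)" for x
      using GDERIV_grad[OF \<phi>_diff] by (simp add: gderiv_def)
    have [measurable]: "grad \<phi> \<in> borel_measurable borel"
      by (intro borel_measurable_continuous_onI grad_cont)
    have [measurable]: "\<phi> \<in> borel_measurable borel"
      by (intro borel_measurable_continuous_onI continuous_at_imp_continuous_on ballI
          differentiable_imp_continuous_within \<phi>_diff)
    have \<phi>_lip: "\<bar>\<phi> y - \<phi> x\<bar> \<le> K2 * norm (y - x)" for x y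
    proof -
      have "norm (\<phi> y - \<phi> x) \<le> K2 * norm (y - x)"
      proof (rule differentiable_bound[OF convex_UNIV])
        show "(\<phi> has_derivative (\<lambda>h. h \<bullet> grad \<phi> z)) (at z within UNIV)" for z
          using \<phi>_deriv by simp
        show "onorm (\<lambda>h. h \<bullet> grad \<phi> z) \<le> K2" for z
        proof (rule onorm_bound[OF K2_nonneg])
          fix h
          have "norm (h \<bullet> grad \<phi> z) \<le> norm h * norm (grad \<phi> z)"
            by (simp add: Cauchy_Schwarz_ineq2)
          also have "\<dots> \<le> norm h * K2" by (intro mult_left_mono K2) auto
          finally show "norm (h \<bullet> grad \<phi> z) \<le> K2 * norm h" by (simp add: mult.commute)
        qed
      qed auto
      then show ?thesis by simp
    qed
    define g where "g t = (\<integral>w. \<phi> (Z t w) \<partial>\<Omega>)" for t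
    define G where "G t = (\<integral>w. grad \<phi> (Z t w) \<bullet> v (\<rho> t) (Z t w) \<partial>\<Omega>)" for t
    have \<phi>_int: "integrable \<Omega> (\<lambda>w. \<phi> (Z t w))" for t
      by (rule \<Omega>.integrable_const_bound[where B=K1]) (use K1 in auto)
    have Gbound: "norm (grad \<phi> x \<bullet> v (\<rho> t) x) \<le> K2 * B" for x t
    proof -
      have "norm (grad \<phi> x \<bullet> v (\<rho> t) x) \<le> norm (grad \<phi> x) * norm (v (\<rho> t) x)"
        by (simp add: Cauchy_Schwarz_ineq2)
      also have "\<dots> \<le> K2 * B"
        by (intro mult_mono K2 v_bound \<rho>_prob \<rho>_sets K2_nonneg) auto
      finally show ?thesis .
    qed
    have G_cont: "continuous_on {0..T} G"
      unfolding continuous_on_sequentially comp_def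
    proof (intro allI ballI impI)
      fix X t assume X: "t \<in> {0..T}" "(\<forall>n. X n \<in> {0..T}) \<and> X \<longlonglongrightarrow> t"
      show "(\<lambda>n. G (X n)) \<longlonglongrightarrow> G t"
        unfolding G_def
      proof (rule integral_dominated_convergence[where w="\<lambda>_. K2 * B"])
        show "AE w in \<Omega>. (\<lambda>n. grad \<phi> (Z (X n) w) \<bullet> v (\<rho> (X n)) (Z (X n) w))
            \<longlonglongrightarrow> grad \<phi> (Z t w) \<bullet> v (\<rho> t) (Z t w)"
          using Z_conv v_conv
        proof eventually_elim
          case (elim w)
          have "(\<lambda>n. grad \<phi> (Z (X n) w)) \<longlonglongrightarrow> grad \<phi> (Z t w)"
          proof (rule isCont_tendsto_compose[of _ "grad \<phi>"])
            show "isCont (grad \<phi>) (Z t w)"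
              using grad_cont by (simp add: continuous_on_eq_continuous_at)
            show "(\<lambda>n. Z (X n) w) \<longlonglongrightarrow> Z t w"
              by (rule elim(1)[rule_format]) (use X in auto)
          qed
          then show ?case
            by (intro tendsto_inner elim(2)[rule_format]) (use X in auto)
        qed
      qed (use Gbound in auto)
    qed
    \<comment> \<open>Differentiation under the expectation: the Lipschitz bounds of
      \<open>\<phi>\<close> and of the paths dominate all difference quotients by
      \<open>K2 * B\<close>.\<close>
    have g_deriv: "(g has_vector_derivative G t) (at t within {0..T})" if t: "t \<in> {0..T}" for t
      unfolding has_real_derivative_iff_has_vector_derivative[symmetric]
        has_field_derivative_iff tendsto_at_iff_sequentially comp_def
    proof (intro allI impI)
      fix X assume X: "\<forall>i. X i \<in> {0..T} - {t}" "X \<longlonglongrightarrow> t"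
      have "(\<lambda>i. \<integral>w. (\<phi> (Z (X i) w) - \<phi> (Z t w)) / (X i - t) \<partial>\<Omega>) \<longlonglongrightarrow> G t"
        unfolding G_def
      proof (rule integral_dominated_convergence[where w="\<lambda>_. K2 * B"])
        show "AE w in \<Omega>. (\<lambda>i. (\<phi> (Z (X i) w) - \<phi> (Z t w)) / (X i - t))
            \<longlonglongrightarrow> grad \<phi> (Z t w) \<bullet> v (\<rho> t) (Z t w)"
          using Z_deriv[of T]
        proof eventually_elim
          case (elim w)
          have "((\<lambda>s. Z s w) has_derivative (\<lambda>h. h *\<^sub>R v (\<rho> t) (Z t w))) (at t within {0..T})"
            using elim t by (auto simp: has_vector_derivative_def)
          from has_derivative_compose[OF this \<phi>_deriv]
          have "((\<lambda>s. \<phi> (Z s w)) has_field_derivative grad \<phi> (Z t w) \<bullet> v (\<rho> t) (Z t w))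
              (at t within {0..T})"
            by (simp add: has_field_derivative_def inner_commute mult.commute[of _ "_ \<bullet> _"])
          then show ?case
            unfolding has_field_derivative_iff tendsto_at_iff_sequentially comp_def
            using X by blast
        qed
        show "AE w in \<Omega>. norm ((\<phi> (Z (X i) w) - \<phi> (Z t w)) / (X i - t)) \<le> K2 * B" for i
          using Z_lip
        proof eventually_elim
          case (elim w)
          have "\<bar>\<phi> (Z (X i) w) - \<phi> (Z t w)\<bar> \<le> K2 * norm (Z (X i) w - Z t w)"
            by (rule \<phi>_lip)
          also have "\<dots> \<le> K2 * (B * \<bar>X i - t\<bar>)"
            using elim X t by (intro mult_left_mono K2_nonneg) auto
          finally show ?case
            using X by (simp add: divide_le_eq mult.assoc)
        qed
      qed auto
      moreover have "(\<integral>w. (\<phi> (Z (X i) w) - \<phi> (Z t w)) / (X i - t) \<partial>\<Omega>) = (g (X i) - g t) / (X i - t)" for i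
        unfolding g_def using \<phi>_int by simp
      ultimately show "(\<lambda>i. (g (X i) - g t) / (X i - t)) \<longlonglongrightarrow> G t" by (simp only:)
    qed
    have "(LBINT s:{0..T}. G s) = g T - g 0"
      unfolding set_lebesgue_integral_def
      by (rule integral_FTC_Icc[OF T g_deriv G_cont]) auto
    moreover have "g t = (\<integral>x. \<phi> x \<partial>\<rho> t)" for t
      unfolding g_def by (rule \<rho>_integral[symmetric]) measurable
    moreover have "G t = (\<integral>x. grad \<phi> x \<bullet> v (\<rho> t) x \<partial>\<rho> t)" for t
      unfolding G_def by (rule \<rho>_integral[symmetric]) measurable
    ultimately show ?thesis by (simp add: \<rho>_0)
  qed

  \<comment> \<open>A path moves by at most \<open>B * t\<close>, so the second moment of the datum
    controls later ones through (a + b)^2 \<le> 2 a^2 + 2 b^2.\<close>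
  have \<rho>_P2: "\<rho> t \<in> P2" if t: "0 \<le> t" for t
  proof -
    have "integrable \<Omega> (\<lambda>w. (norm (Z 0 w))\<^sup>2)"
      using \<mu>'(3) unfolding Z_law[symmetric] by (simp add: integrable_distr_eq)
    then have "integrable \<Omega> (\<lambda>w. 2 * (norm (Z 0 w))\<^sup>2 + 2 * (B * t)\<^sup>2)" by simp
    then have "integrable \<Omega> (\<lambda>w. (norm (Z t w))\<^sup>2)"
    proof (rule Bochner_Integration.integrable_bound)
      show "AE w in \<Omega>. norm ((norm (Z t w))\<^sup>2) \<le> norm (2 * (norm (Z 0 w))\<^sup>2 + 2 * (B * t)\<^sup>2)"
        using Z_lip
      proof eventually_elim
        case (elim w)
        have "norm (Z t w) \<le> norm (Z 0 w) + norm (Z t w - Z 0 w)"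
          by (simp add: norm_triangle_sub)
        also have "norm (Z t w - Z 0 w) \<le> B * t" using elim[rule_format, of 0 t] t by simp
        finally have "(norm (Z t w))\<^sup>2 \<le> (norm (Z 0 w) + B * t)\<^sup>2"
          by (intro power_mono) auto
        also have "\<dots> \<le> 2 * (norm (Z 0 w))\<^sup>2 + 2 * (B * t)\<^sup>2"
          using zero_le_power2[of "norm (Z 0 w) - B * t"]
          by (simp add: power2_eq_square algebra_simps)
        finally show ?case by simp
      qed
    qed simp
    then show ?thesis
      using \<rho>_prob \<rho>_sets by (simp add: P2_def \<rho>_def integrable_distr_eq)
  qed
  \<comment> \<open>Paths with a common Lipschitz constant give a Lipschitz curve of laws, so the
    constant \<open>B\<close> serves as dominating function.\<close>
  have AC: "AC_curve T \<rho>" for T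
    unfolding AC_curve_def
  proof (intro conjI ballI exI[of _ "\<lambda>_. B"] allI impI)
    show "set_integrable lborel {0..T} (\<lambda>_. B)"
      by (rule borel_integrable_atLeastAtMost') simp
    fix s t assume st: "0 \<le> s \<and> s \<le> t \<and> t \<le> T"
    have "AE w in \<Omega>. norm (Z t w - Z s w) \<le> B * (t - s)"
      using Z_lip
    proof eventually_elim
      case (elim w)
      then show ?case using st elim[rule_format, of s t] by simp
    qed
    then have "dW (\<rho> s) (\<rho> t) \<le> B * (t - s)"
      unfolding \<rho>_def by (rule dW_le_distr[OF \<Omega> Z_meas Z_meas])
    then show "dW (\<rho> s) (\<rho> t) \<le> (LBINT r:{s..t}. B)"
      using st by (simp add: set_lebesgue_integral_def mult.commute)
  qed (use \<rho>_P2 in auto)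
  show ?thesis
    by (rule that[OF \<rho>_0 AC weak])
qed

end

section \<open>The drift as a nonlocal field\<close>

lemma lborel_distr_reflect: "distr lborel borel (\<lambda>y. c - y) = (lborel :: 'a::euclidean_space measure)"
  using lborel_affine[of "-1" c] by (simp add: density_1)

lemma integrable_reflect:
  fixes f :: "'a::euclidean_space \<Rightarrow> 'b::{banach, second_countable_topology}"
  assumes f: "integrable lborel f"
  shows "integrable lborel (\<lambda>y. f (c - y))"
proof -
  have [measurable]: "f \<in> borel_measurable borel" using f by simp
  from f show ?thesis
    by (subst (asm) lborel_distr_reflect[of c, symmetric]) (simp add: integrable_distr_eq)
qed

lemma integral_reflect:
  fixes f :: "'a::euclidean_space \<Rightarrow> 'b::{banach, second_countable_topology}"
  assumes "f \<in> borel_measurable borel"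
  shows "(\<integral>y. f (c - y) \<partial>lborel) = (\<integral>y. f y \<partial>lborel)"
  using assms by (subst (2) lborel_distr_reflect[of c, symmetric]) (simp add: integral_distr)

lemma integrable_lborel_scaleR:
  fixes f :: "'a::euclidean_space \<Rightarrow> 'b::{banach, second_countable_topology}"
  assumes f: "integrable lborel f" and c: "c \<noteq> 0"
  shows "integrable lborel (\<lambda>x. f (c *\<^sub>R x))"
proof -
  have [measurable]: "f \<in> borel_measurable borel" using f by simp
  have "integrable (density (distr lborel borel (\<lambda>x. 0 + c *\<^sub>R x)) (\<lambda>_. ennreal (\<bar>c\<bar> ^ DIM('a)))) f"
    using f lborel_affine[OF c, of "0 :: 'a"] by (simp only:)
  then have "integrable lborel (\<lambda>x. \<bar>c\<bar> ^ DIM('a) *\<^sub>R f (c *\<^sub>R x))"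
    by (subst (asm) integrable_density) (auto simp: integrable_distr_eq)
  from integrable_scaleR_right[OF this, of "inverse (\<bar>c\<bar> ^ DIM('a))"] show ?thesis
    using c by simp
qed

text \<open>Scheffe's lemma: by continuity of \<open>G\<close> the translates converge pointwise,
  and by invariance of Lebesgue measure they all have the same L1 norm.\<close>

lemma L1_continuous_translation:
  fixes G :: "'a::euclidean_space \<Rightarrow> 'b::{banach, second_countable_topology}"
  assumes cont: "continuous_on UNIV G" and int: "integrable lborel G" and x: "xs \<longlonglongrightarrow> x"
  shows "(\<lambda>n. \<integral>y. norm (G (xs n - y) - G (x - y)) \<partial>lborel) \<longlonglongrightarrow> 0"
proof -
  have [measurable]: "G \<in> borel_measurable borel" using int by simp
  have nn: "(\<integral>\<^sup>+y. norm (G (c - y)) \<partial>lborel) = (\<integral>\<^sup>+y. norm (G y) \<partial>lborel)" for c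
    by (subst (2) lborel_distr_reflect[of c, symmetric]) (simp add: nn_integral_distr)
  have "(\<lambda>n. \<integral>\<^sup>+y. norm (G (xs n - y) - G (x - y)) \<partial>lborel) \<longlonglongrightarrow> 0"
  proof (rule Scheffe_lemma2)
    show "AE y in lborel. (\<lambda>n. G (xs n - y)) \<longlonglongrightarrow> G (x - y)"
    proof (intro AE_I2)
      fix y
      show "(\<lambda>n. G (xs n - y)) \<longlonglongrightarrow> G (x - y)"
        by (rule isCont_tendsto_compose[of _ G])
           (use cont x in \<open>auto simp: continuous_on_eq_continuous_at intro!: tendsto_diff\<close>)
    qed
  qed (auto intro: integrable_reflect int simp: nn)
  moreover have "(\<integral>\<^sup>+y. norm (G (xs n - y) - G (x - y)) \<partial>lborel)
      = ennreal (\<integral>y. norm (G (xs n - y) - G (x - y)) \<partial>lborel)" for n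
    by (intro nn_integral_eq_integral integrable_norm Bochner_Integration.integrable_diff
        integrable_reflect int) auto
  ultimately have "(\<lambda>n. ennreal (\<integral>y. norm (G (xs n - y) - G (x - y)) \<partial>lborel)) \<longlonglongrightarrow> ennreal 0"
    by simp
  then show ?thesis
    by (rule tendsto_ennrealD) (auto intro!: always_eventually)
qed

lemma
  fixes V :: "'a::euclidean_space \<Rightarrow> real"
  assumes \<rho>: "prob_space \<rho>" "sets \<rho> = sets borel"
    and V: "continuous_on UNIV V" "\<And>x. 0 \<le> V x" "\<And>x. V x \<le> M"
  shows conv_measure_bounds: "0 \<le> conv_measure V \<rho> y" "conv_measure V \<rho> y \<le> M"
    and continuous_on_conv_measure: "continuous_on UNIV (conv_measure V \<rho>)"
proof -
  interpret prob_space \<rho> by (rule \<rho>)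
  note \<rho>(2)[measurable_cong]
  have [measurable]: "V \<in> borel_measurable borel"
    by (intro borel_measurable_continuous_onI V)
  have int: "integrable \<rho> (\<lambda>z. V (y - z))" for y
    by (rule integrable_const_bound[where B=M]) (use V in auto)
  show "0 \<le> conv_measure V \<rho> y"
    unfolding conv_measure_def using V by (simp add: integral_nonneg)
  have "(\<integral>z. V (y - z) \<partial>\<rho>) \<le> (\<integral>z. M \<partial>\<rho>)"
    by (intro integral_mono int) (use V in auto)
  then show "conv_measure V \<rho> y \<le> M"
    unfolding conv_measure_def by (simp add: prob_space)
  show "continuous_on UNIV (conv_measure V \<rho>)"
    unfolding continuous_on_sequentially comp_def conv_measure_def
  proof (intro allI ballI impI)
    fix X :: "nat \<Rightarrow> 'a" and y assume X: "(\<forall>n. X n \<in> UNIV) \<and> X \<longlonglongrightarrow> y"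
    show "(\<lambda>n. \<integral>z. V (X n - z) \<partial>\<rho>) \<longlonglongrightarrow> (\<integral>z. V (y - z) \<partial>\<rho>)"
    proof (rule integral_dominated_convergence[where w="\<lambda>_. M"])
      show "AE z in \<rho>. (\<lambda>n. V (X n - z)) \<longlonglongrightarrow> V (y - z)"
      proof (intro AE_I2)
        fix z
        show "(\<lambda>n. V (X n - z)) \<longlonglongrightarrow> V (y - z)"
          by (rule isCont_tendsto_compose[of _ V])
             (use V(1) X in \<open>auto simp: continuous_on_eq_continuous_at intro!: tendsto_diff\<close>)
      qed
    qed (use V in auto)
  qed
qed

text \<open>The velocity is minus the drift. A change of position is controlled by L1 continuity of
  translations, since the weights F'(V * \<rho>) are bounded by one constant \<open>L\<close>. A
  change of measure makes the weights converge pointwise, because each translate of the reflected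
  kernel is a bounded continuous test function, and dominated convergence applies.\<close>

lemma nonlocal_field_drift:
  fixes V :: "'a::euclidean_space \<Rightarrow> real"
  assumes V: "continuous_on UNIV V" "\<And>x. 0 \<le> V x" "\<And>x. V x \<le> M"
    and grad_cont: "continuous_on UNIV (grad V)" and grad_int: "integrable lborel (grad V)"
    and F: "continuous_on {0..} (deriv_halfline F)"
  shows "\<exists>B. nonlocal_field (\<lambda>\<rho> x. - drift V F \<rho> x) B"
proof -
  have [measurable]: "grad V \<in> borel_measurable borel" using grad_int by simp
  have "compact (deriv_halfline F ` {0..M})"
    by (intro compact_continuous_image continuous_on_subset[OF F]) auto
  from compact_imp_bounded[OF this]
  obtain L where "\<forall>s\<in>{0..M}. \<bar>deriv_halfline F s\<bar> \<le> L"
    unfolding bounded_iff by auto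
  then have L: "\<bar>deriv_halfline F s\<bar> \<le> L" if "0 \<le> s" "s \<le> M" for s
    using that by simp
  define a where "a \<rho> y = deriv_halfline F (conv_measure V \<rho> y)" for \<rho> y
  have a_bound: "\<bar>a \<rho> y\<bar> \<le> L" if "prob_space \<rho>" "sets \<rho> = sets borel" for \<rho> y
    unfolding a_def using that V by (intro L conv_measure_bounds)
  have a_meas: "a \<rho> \<in> borel_measurable borel"
    if \<rho>: "prob_space \<rho>" "sets \<rho> = sets borel" for \<rho>
    unfolding a_def
  proof (intro borel_measurable_continuous_onI continuous_on_compose2[OF F])
    show "continuous_on UNIV (conv_measure V \<rho>)"
      by (rule continuous_on_conv_measure[OF \<rho> V])
    show "conv_measure V \<rho> ` UNIV \<subseteq> {0..}"
      using conv_measure_bounds(1)[OF \<rho> V] by auto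
  qed
  have drift_eq: "drift V F \<rho> x = (\<integral>y. a \<rho> y *\<^sub>R grad V (x - y) \<partial>lborel)" for \<rho> x
    by (simp add: drift_def conv_fun_def a_def)
  have weighted_int: "integrable lborel (\<lambda>y. a \<rho> y *\<^sub>R H y)"
    and weighted_bound: "norm (\<integral>y. a \<rho> y *\<^sub>R H y \<partial>lborel) \<le> L * (\<integral>y. norm (H y) \<partial>lborel)"
    if \<rho>: "prob_space \<rho>" "sets \<rho> = sets borel" and H: "integrable lborel H"
    for \<rho> and H :: "'a \<Rightarrow> 'a"
  proof -
    note [measurable] = a_meas[OF \<rho>]
    have le: "norm (a \<rho> y *\<^sub>R H y) \<le> L * norm (H y)" for y
      using a_bound[OF \<rho>] by (simp add: mult_right_mono)
    show int: "integrable lborel (\<lambda>y. a \<rho> y *\<^sub>R H y)"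
    proof (rule Bochner_Integration.integrable_bound)
      show "AE y in lborel. norm (a \<rho> y *\<^sub>R H y) \<le> norm (L * norm (H y))"
        unfolding real_norm_def using order_trans[OF le abs_ge_self] by (rule AE_I2)
    qed (use H in simp_all)
    have "norm (\<integral>y. a \<rho> y *\<^sub>R H y \<partial>lborel) \<le> (\<integral>y. norm (a \<rho> y *\<^sub>R H y) \<partial>lborel)"
      by (rule integral_norm_bound)
    also have "\<dots> \<le> (\<integral>y. L * norm (H y) \<partial>lborel)"
      by (rule integral_mono[OF integrable_norm[OF int] _ le]) (use H in simp)
    finally show "norm (\<integral>y. a \<rho> y *\<^sub>R H y \<partial>lborel) \<le> L * (\<integral>y. norm (H y) \<partial>lborel)"
      by simp
  qed
  note refl_int = integrable_reflect[OF grad_int]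
  have "nonlocal_field (\<lambda>\<rho> x. - drift V F \<rho> x) (L * (\<integral>y. norm (grad V y) \<partial>lborel))"
  proof
    fix \<rho> :: "'a measure" and x :: 'a
    assume \<rho>: "prob_space \<rho>" "sets \<rho> = sets borel"
    show "norm (- drift V F \<rho> x) \<le> L * (\<integral>y. norm (grad V y) \<partial>lborel)"
      using weighted_bound[OF \<rho> refl_int[of x]]
      by (simp add: drift_eq integral_reflect[of "\<lambda>y. norm (grad V y)"])
  next
    fix \<rho>s :: "nat \<Rightarrow> 'a measure" and \<rho> :: "'a measure" and xs :: "nat \<Rightarrow> 'a" and x :: 'a
    assume \<rho>s: "\<And>n. prob_space (\<rho>s n)" "\<And>n. sets (\<rho>s n) = sets borel"
      and \<rho>: "prob_space \<rho>" "sets \<rho> = sets borel"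
      and conv: "\<And>\<phi> :: 'a \<Rightarrow> real. continuous_on UNIV \<phi> \<Longrightarrow> bounded (range \<phi>) \<Longrightarrow>
         (\<lambda>n. \<integral>y. \<phi> y \<partial>\<rho>s n) \<longlonglongrightarrow> (\<integral>y. \<phi> y \<partial>\<rho>)"
      and xs: "xs \<longlonglongrightarrow> x"
    note [measurable] = a_meas[OF \<rho>] a_meas[OF \<rho>s]
    have a_lim: "(\<lambda>n. a (\<rho>s n) y) \<longlonglongrightarrow> a \<rho> y" for y
    proof -
      have "(\<lambda>n. conv_measure V (\<rho>s n) y) \<longlonglongrightarrow> conv_measure V \<rho> y"
        unfolding conv_measure_def
      proof (rule conv)
        show "continuous_on UNIV (\<lambda>z. V (y - z))"
          by (intro continuous_on_compose2[OF V(1)] continuous_intros) auto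
        show "bounded (range (\<lambda>z. V (y - z)))"
          unfolding bounded_iff using V by (auto intro!: exI[of _ M])
      qed
      then show ?thesis
        unfolding a_def
        by (intro continuous_on_tendsto_compose[OF F])
           (auto intro!: always_eventually conv_measure_bounds(1)[OF \<rho> V]
             conv_measure_bounds(1)[OF \<rho>s V])
    qed
    have diff_int: "integrable lborel (\<lambda>y. grad V (xs n - y) - grad V (x - y))" for n
      by (intro Bochner_Integration.integrable_diff refl_int)
    have "(\<lambda>n. \<integral>y. a (\<rho>s n) y *\<^sub>R (grad V (xs n - y) - grad V (x - y)) \<partial>lborel) \<longlonglongrightarrow> 0"
    proof (rule Lim_null_comparison[OF always_eventually])
      show "\<forall>n. norm (\<integral>y. a (\<rho>s n) y *\<^sub>R (grad V (xs n - y) - grad V (x - y)) \<partial>lborel)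
          \<le> L * (\<integral>y. norm (grad V (xs n - y) - grad V (x - y)) \<partial>lborel)"
        using weighted_bound[OF \<rho>s diff_int] by blast
      show "(\<lambda>n. L * (\<integral>y. norm (grad V (xs n - y) - grad V (x - y)) \<partial>lborel)) \<longlonglongrightarrow> 0"
        using tendsto_mult_left[OF L1_continuous_translation[OF grad_cont grad_int xs], of L]
        by simp
    qed
    moreover have "(\<lambda>n. \<integral>y. a (\<rho>s n) y *\<^sub>R grad V (x - y) \<partial>lborel)
        \<longlonglongrightarrow> (\<integral>y. a \<rho> y *\<^sub>R grad V (x - y) \<partial>lborel)"
    proof (rule integral_dominated_convergence[where w="\<lambda>y. L * norm (grad V (x - y))"])
      show "integrable lborel (\<lambda>y. L * norm (grad V (x - y)))"
        using refl_int by simp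
      show "AE y in lborel. norm (a (\<rho>s n) y *\<^sub>R grad V (x - y)) \<le> L * norm (grad V (x - y))" for n
        using a_bound[OF \<rho>s] by (simp add: mult_right_mono)
      show "AE y in lborel. (\<lambda>n. a (\<rho>s n) y *\<^sub>R grad V (x - y)) \<longlonglongrightarrow> a \<rho> y *\<^sub>R grad V (x - y)"
        by (intro AE_I2 tendsto_scaleR a_lim tendsto_const)
    qed simp_all
    ultimately have "(\<lambda>n. (\<integral>y. a (\<rho>s n) y *\<^sub>R (grad V (xs n - y) - grad V (x - y)) \<partial>lborel)
        + (\<integral>y. a (\<rho>s n) y *\<^sub>R grad V (x - y) \<partial>lborel)) \<longlonglongrightarrow> 0 + drift V F \<rho> x"
      unfolding drift_eq by (rule tendsto_add)
    moreover have "(\<integral>y. a (\<rho>s n) y *\<^sub>R (grad V (xs n - y) - grad V (x - y)) \<partial>lborel)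
        + (\<integral>y. a (\<rho>s n) y *\<^sub>R grad V (x - y) \<partial>lborel) = drift V F (\<rho>s n) (xs n)" for n
      unfolding drift_eq
      using Bochner_Integration.integral_add[OF weighted_int[OF \<rho>s diff_int]
          weighted_int[OF \<rho>s refl_int], symmetric]
      by (simp add: scaleR_right_diff_distrib)
    ultimately show "(\<lambda>n. - drift V F (\<rho>s n) (xs n)) \<longlonglongrightarrow> - drift V F \<rho> x"
      by (simp add: tendsto_minus)
  qed
  then show ?thesis by blast
qed

section \<open>The rescaled kernel and the existence theorem\<close>

lemma GDERIV_rescale:
  fixes V :: "'a::euclidean_space \<Rightarrow> real"
  assumes V: "V differentiable (at (x /\<^sub>R \<epsilon>))"
  shows "GDERIV (rescale \<epsilon> V) x :> grad V (x /\<^sub>R \<epsilon>) /\<^sub>R \<epsilon> ^ Suc DIM('a)"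
proof -
  have V': "(V has_derivative (\<lambda>h. h \<bullet> grad V (x /\<^sub>R \<epsilon>))) (at (x /\<^sub>R \<epsilon>))"
    using GDERIV_grad[OF V] by (simp only: gderiv_def)
  have "((\<lambda>x. x /\<^sub>R \<epsilon>) has_derivative (\<lambda>h. h /\<^sub>R \<epsilon>)) (at x)"
    by (rule has_derivative_scaleR_right[OF has_derivative_ident])
  from has_derivative_compose[OF this V']
  have "((\<lambda>x. V (x /\<^sub>R \<epsilon>) * inverse (\<epsilon> ^ DIM('a))) has_derivative
      (\<lambda>h. ((h /\<^sub>R \<epsilon>) \<bullet> grad V (x /\<^sub>R \<epsilon>)) * inverse (\<epsilon> ^ DIM('a)))) (at x)"
    by (rule has_derivative_mult_left)
  then show ?thesis
    unfolding gderiv_def rescale_def[abs_def] by (simp add: divide_inverse mult_ac)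
qed

theorem theorem2p1:
  fixes T \<epsilon> C \<alpha> :: real
    and V1 :: "'a::euclidean_space \<Rightarrow> real"
    and F :: "real \<Rightarrow> ereal"
    and \<rho>0 :: "'a measure"
  assumes T_pos: "T > 0" and eps_pos: "\<epsilon> > 0"
    and V1_nonneg: "\<And>x. V1 x \<ge> 0"
    and V1_cont: "continuous_on UNIV V1"
    and V1_bounded: "bounded (range V1)"
    and V1_C1: "C1 V1"
    and V1_integrable: "integrable lborel V1"
    and V1_L1_norm: "(\<integral>x. \<bar>V1 x\<bar> \<partial>lborel) = 1"
    and V1_even: "\<And>x. V1 x = V1 (- x)"
    and V1_moment: "integrable lborel (\<lambda>x. (norm x)\<^sup>2 * V1 x)"
    and V1_grad_L1: "integrable lborel (\<lambda>x. norm (grad V1 x))"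
    and V1_grad_growth: "\<And>x. norm (grad V1 x) \<le> C * (1 + norm x)"
    and F_proper: "proper_halfline F"
    and F_convex: "convex_halfline F"
    and F_lsc: "lsc_halfline F"
    and F_zero: "F 0 = 0"
    and F_superlinear: "Liminf at_top (\<lambda>s. F s / ereal s) = \<infinity>"
    and alpha: "\<alpha> > real DIM('a) / (real DIM('a) + 2)"
    and F_near_zero: "Liminf (at_right 0) (\<lambda>s. F s / ereal (s powr \<alpha>)) > - \<infinity>"
    and F_C1: "C1_halfline F"
    and rho0: "\<rho>0 \<in> P2"
    and rho0_energy: "energy (rescale \<epsilon> V1) F \<rho>0 < \<infinity>"
  shows "\<exists>\<rho> :: real \<Rightarrow> 'a measure.
           weak_measure_solution T (rescale \<epsilon> V1) F \<rho>0 \<rho> \<and> \<rho> 0 = \<rho>0"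
proof -
  let ?V = "rescale \<epsilon> V1"
  have V1_diff: "V1 differentiable (at x)" and V1_grad_cont: "continuous_on UNIV (grad V1)" for x
    using V1_C1 by (auto simp: C1_def)
  obtain M where M: "\<And>x. \<bar>V1 x\<bar> \<le> M"
    using V1_bounded by (auto simp: bounded_iff)
  have grad_V: "grad ?V = (\<lambda>x. grad V1 (x /\<^sub>R \<epsilon>) /\<^sub>R \<epsilon> ^ Suc DIM('a))"
    by (intro ext grad_eqI GDERIV_rescale V1_diff)
  have [measurable]: "grad V1 \<in> borel_measurable borel"
    by (intro borel_measurable_continuous_onI V1_grad_cont)
  \<comment> \<open>Continuity makes the gradient measurable, so integrability of its norm gives
    Bochner integrability.\<close>
  have V1_grad_int: "integrable lborel (grad V1)"
    using V1_grad_L1 by (simp add: integrable_norm_iff)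
  have "\<exists>B. nonlocal_field (\<lambda>\<rho> x. - drift ?V F \<rho> x) B"
  proof (rule nonlocal_field_drift)
    show "continuous_on UNIV ?V"
      unfolding rescale_def[abs_def] divide_inverse
      by (intro continuous_intros continuous_on_compose2[OF V1_cont]) auto
    show "0 \<le> ?V x" for x
      using V1_nonneg eps_pos by (simp add: rescale_def)
    show "?V x \<le> M / \<epsilon> ^ DIM('a)" for x
      using M[of "x /\<^sub>R \<epsilon>"] eps_pos by (simp add: rescale_def divide_right_mono)
    show "continuous_on UNIV (grad ?V)"
      unfolding grad_V
      by (intro continuous_intros continuous_on_compose2[OF V1_grad_cont]) auto
    show "integrable lborel (grad ?V)"
      unfolding grad_V using integrable_lborel_scaleR[OF V1_grad_int, of "inverse \<epsilon>"] eps_pos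
      by simp
    show "continuous_on {0..} (deriv_halfline F)"
      using F_C1 by (simp add: C1_halfline_def)
  qed
  then obtain B where "nonlocal_field (\<lambda>\<rho> x. - drift ?V F \<rho> x) B" by blast
  then interpret nonlocal_field "\<lambda>\<rho> x. - drift ?V F \<rho> x" B .
  obtain \<rho> where \<rho>: "\<rho> 0 = \<rho>0" "\<And>T. AC_curve T \<rho>"
    "\<And>\<phi> t. C1c \<phi> \<Longrightarrow> 0 \<le> t \<Longrightarrow> (\<integral>x. \<phi> x \<partial>\<rho> t) - (\<integral>x. \<phi> x \<partial>\<rho>0)
        = (LBINT s:{0..t}. (\<integral>x. grad \<phi> x \<bullet> - drift ?V F (\<rho> s) x \<partial>\<rho> s))"
    using weak_solution_exists[OF rho0] by blast
  \<comment> \<open>The minus sign of the velocity is pulled out of both integrals, which gives the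
    sign convention of the weak formulation.\<close>
  have "weak_measure_solution T ?V F \<rho>0 \<rho>"
    unfolding weak_measure_solution_def
    using \<rho>(2,3) by (simp add: set_lebesgue_integral_def)
  with \<rho>(1) show ?thesis by blast
qed

end
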